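(* Let $\lambda,\mu\in\mathbb{C}$, let $\theta_g,\theta_f\in[0,1]$, and assume $M=\Delta T/\Delta t=2$. Let $a,b,A,B$ be the coefficients of the fine and coarse stochastic $\theta$-methods for the equation $du(t)=\lambda u(t)\,dt+\mu u(t)\,dW(t)$, $u(0)=u_0\neq 0$, $t\in[0,T]$, given explicitly in the context, and assume that $$\mathrm{Im}\left(A\,\overline{a}^2+\sqrt{2}\,B\,\overline{ab}\right)=0 .$$ Let $\{u_n\}$ be the sequence generated serially by the fine propagator, and let $\{U_n^k\}$ and $\{\alpha_n^k\}$ be generated by the SParareal scheme described in the context, where $\alpha_n^k$ is defined by sampling rule 2 or by sampling rule 4 (described in the context). Define $\epsilon_n^k=\mathbb{E}\left[|U_n^k-u_n|^2\right]$ and $\widehat{\epsilon}^{(k)}=\sup_n \epsilon_n^k$. Set $$\gamma=|A|^2+|B|^2,$$ $$\alpha=|A|^2+|B|^2+\left|A\overline{a}^2-|B|^2-|A|^2+\sqrt{2}B\,\overline{ab}\right|,$$ $$\beta=-2\,\mathrm{Re}(\overline{A}a^2)+|A|^2+|B|^2-2\sqrt{2}\,\mathrm{Re}(\overline{B}ab)+(|a|^2+|b|^2)^2+\left|A\overline{a}^2-|B|^2-|A|^2+\sqrt{2}B\,\overline{ab}\right|.$$ If $\alpha<1$, then for every iteration index $k\ge 0$ $$\widehat{\epsilon}^{(k)}\le \widehat{\epsilon}^{(0)}\left[\frac{\frac{2\beta(1+2\gamma)}{1-\alpha}+\sqrt{\left(\frac{2\beta(1+2\gamma)}{1-\alpha}\right)^2+4\,\frac{4\beta\gamma}{1-\alpha}}}{2}\right]^k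 .$$
   Context: Time grid: $[0,T]$ is divided into $N$ subintervals $[T_n,T_{n+1}]$, $T_n=n\Delta T$, $n=0,\dots,N-1$, with $\Delta T=T/N$. The coarse propagator takes one step of size $\Delta T$ on each subinterval, and the fine propagator takes $M=2$ steps of size $\Delta t=\Delta T/2$. $W$ is a standard (real) Wiener process. The supremum $\sup_n$ is over $n=0,\dots,N$. Noise: for $n=0,\dots,N-1$ and $j=0,1$, $$\sqrt{\Delta t}\,\upsilon_{n+\frac{j}{2}}=W(n\Delta T+(j+1)\Delta t)-W(n\Delta T+j\Delta t),\qquad \sqrt{\Delta T}\,V_n=W((n+1)\Delta T)-W(n\Delta T),$$ so the $\upsilon_{n+\frac{j}{2}}$ are independent $\mathcal{N}(0,1)$ variables and $V_n=\frac{1}{\sqrt2}(\upsilon_n+\upsilon_{n+\frac12})$. Coefficients (stochastic $\theta$-method with parameter $\theta_f$ for the fine propagator and $\theta_g$ for the coarse propagator; the denominators are assumed nonzero): $$a=\frac{1+(1-\theta_f)\Delta t\,\lambda}{1-\theta_f\Delta t\,\lambda},\quad b=\frac{\sqrt{\Delta t}\,\mu}{1-\theta_f\Delta t\,\lambda},\quad A=\frac{1+(1-\theta_g)\Delta T\,\lambda}{1-\theta_g\Delta T\,\lambda},\quad B=\frac{\sqrt{\Delta T}\,\mu}{1-\theta_g\Delta T\,\lambda}.$$ Propagators over $[T_n,T_{n+1}]$ applied to a value $U$ at time $T_n$: $$\mathcal{F}_{\Delta t}(U)=(a+b\upsilon_{n+\frac12})(a+b\upsilon_n)\,U,\qquad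 \mathcal{G}_{\Delta T}(U)=(A+BV_n)\,U.$$ The serial fine solution is $u_{n+1}=\mathcal{F}_{\Delta t}(u_n)$ for $n=0,\dots,N-1$, with initial value $u_0$. SParareal scheme: $U_0^k=u_0$ for all $k\ge0$; $U_{n+1}^0=\mathcal{G}_{\Delta T}(U_n^0)$; and for $k\ge 0$, $0\le n\le N-1$, $$U_{n+1}^{k+1}=(A+BV_n)U_n^{k+1}+\left[(a+b\upsilon_{n+\frac12})(a+b\upsilon_n)-(A+BV_n)\right]\alpha_n^k .$$ The first iteration is the classical Parareal one, i.e. $\alpha_n^0=U_n^0$, and at the initial time $\alpha_0^k=u_0$. For $k\ge1$, $n\ge1$, put $$\sigma_n^k=\left|\mathcal{G}_{\Delta T}(U_{n-1}^k)-\mathcal{G}_{\Delta T}(U_{n-1}^{k-1})\right|=\left|(A+BV_{n-1})(U_{n-1}^k-U_{n-1}^{k-1})\right| .$$ Sampling rule 2: $\alpha_n^k=U_n^k+\sigma_n^k z_n^k$, where $z_n^k\sim\mathcal{N}(0,1)$. Sampling rule 4: $\alpha_n^k=U_n^k+\sqrt3\,\sigma_n^k(2\omega_n^k-1)$, where $\omega_n^k$ is uniform on $[0,1]$. The variables $z_n^k$ (resp. $\omega_n^k$) are mutually independent and independent of $W$. *)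

theory Defs
  imports "HOL-Probability.Probability"
begin

text \<open>Standard real Wiener process on the time interval \<open>[0,T]\<close>.\<close>

definition standard_wiener :: "'w measure \<Rightarrow> real \<Rightarrow> (real \<Rightarrow> 'w \<Rightarrow> real) \<Rightarrow> bool" where
  "standard_wiener M T W \<longleftrightarrow>
     (\<forall>t\<in>{0..T}. W t \<in> borel_measurable M) \<and>
     (AE \<omega> in M. W 0 \<omega> = 0) \<and>
     (AE \<omega> in M. continuous_on {0..T} (\<lambda>t. W t \<omega>)) \<and>
     (\<forall>s t. 0 \<le> s \<and> s < t \<and> t \<le> T \<longrightarrow>
        distributed M lborel (\<lambda>\<omega>. W t \<omega> - W s \<omega>) (normal_density 0 (sqrt (t - s)))) \<and>
     (\<forall>m (t :: nat \<Rightarrow> real).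
        (\<forall>i\<le>m. t i \<in> {0..T}) \<and> (\<forall>i<m. t i < t (Suc i)) \<longrightarrow>
        prob_space.indep_vars M (\<lambda>_. borel)
          (\<lambda>i \<omega>. W (t (Suc i)) \<omega> - W (t i) \<omega>) {..<m})"

text \<open>
  The family \<open>z\<close> is mutually independent and independent of the whole process \<open>W\<close>.
  The second clause is phrased with the generated \<open>\<sigma>\<close>-algebras because
  \<^const>\<open>prob_space.indep_var\<close> needs both variables to have the same value type.
\<close>

definition indep_noise ::
  "'w measure \<Rightarrow> real \<Rightarrow> (real \<Rightarrow> 'w \<Rightarrow> real) \<Rightarrow> 'i set \<Rightarrow> ('i \<Rightarrow> 'w \<Rightarrow> real) \<Rightarrow> bool" where
  "indep_noise M T W I z \<longleftrightarrow>
     prob_space.indep_vars M (\<lambda>_. borel) z I \<and>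
     prob_space.indep_set M
       (sets (vimage_algebra (space M) (\<lambda>\<omega>. \<lambda>t\<in>{0..T}. W t \<omega>) (PiM {0..T} (\<lambda>_. borel))))
       (sets (vimage_algebra (space M) (\<lambda>\<omega>. \<lambda>i\<in>I. z i \<omega>) (PiM I (\<lambda>_. borel))))"

text \<open>
  One step of size \<open>h\<close> of the stochastic \<open>\<theta>\<close>-method for
  \<open>du = lam u dt + mu u dW\<close> multiplies by
  \<open>theta_drift \<theta> h lam + theta_noise \<theta> h lam mu * \<xi>\<close>, where \<open>\<xi>\<close> is
  the increment of \<open>W\<close> over the step divided by \<open>sqrt h\<close>.
\<close>

definition theta_drift :: "real \<Rightarrow> real \<Rightarrow> complex \<Rightarrow> complex" where
  "theta_drift \<theta> h lam =
     (1 + of_real ((1 - \<theta>) * h) * lam) / (1 - of_real (\<theta> * h) * lam)"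

definition theta_noise :: "real \<Rightarrow> real \<Rightarrow> complex \<Rightarrow> complex \<Rightarrow> complex" where
  "theta_noise \<theta> h lam mu = of_real (sqrt h) * mu / (1 - of_real (\<theta> * h) * lam)"

definition normalized_increment :: "(real \<Rightarrow> 'w \<Rightarrow> real) \<Rightarrow> real \<Rightarrow> real \<Rightarrow> 'w \<Rightarrow> real" where
  "normalized_increment W h t \<omega> = (W (t + h) \<omega> - W t \<omega>) / sqrt h"

text \<open>
  \<open>fine_noise W DT n j\<close> is the variable with index \<open>n + j/2\<close>; the fine step size is
  \<open>DT/2\<close>.
\<close>

definition fine_noise :: "(real \<Rightarrow> 'w \<Rightarrow> real) \<Rightarrow> real \<Rightarrow> nat \<Rightarrow> nat \<Rightarrow> 'w \<Rightarrow> real" where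
  "fine_noise W DT n j = normalized_increment W (DT / 2) (real n * DT + real j * (DT / 2))"

definition coarse_noise :: "(real \<Rightarrow> 'w \<Rightarrow> real) \<Rightarrow> real \<Rightarrow> nat \<Rightarrow> 'w \<Rightarrow> real" where
  "coarse_noise W DT n = normalized_increment W DT (real n * DT)"

text \<open>Propagators over the \<open>n\<close>-th coarse subinterval; both are linear in the value \<open>x\<close>.\<close>

definition fine_prop ::
  "complex \<Rightarrow> complex \<Rightarrow> (real \<Rightarrow> 'w \<Rightarrow> real) \<Rightarrow> real \<Rightarrow> nat \<Rightarrow> 'w \<Rightarrow> complex \<Rightarrow> complex" where
  "fine_prop a b W DT n \<omega> x =
     (a + b * of_real (fine_noise W DT n 1 \<omega>)) * (a + b * of_real (fine_noise W DT n 0 \<omega>)) * x"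

definition coarse_prop ::
  "complex \<Rightarrow> complex \<Rightarrow> (real \<Rightarrow> 'w \<Rightarrow> real) \<Rightarrow> real \<Rightarrow> nat \<Rightarrow> 'w \<Rightarrow> complex \<Rightarrow> complex" where
  "coarse_prop A B W DT n \<omega> x = (A + B * of_real (coarse_noise W DT n \<omega>)) * x"

type_synonym 'w propagator = "nat \<Rightarrow> 'w \<Rightarrow> complex \<Rightarrow> complex"

primrec serial_fine :: "'w propagator \<Rightarrow> complex \<Rightarrow> nat \<Rightarrow> 'w \<Rightarrow> complex" where
  "serial_fine F u0 0 \<omega> = u0"
| "serial_fine F u0 (Suc n) \<omega> = F n \<omega> (serial_fine F u0 n \<omega>)"

text \<open>
  Below, \<open>U k n\<close> and \<open>S k n\<close> are the iterate and the sampled value at iteration \<open>k\<close>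
  and time index \<open>n\<close>. The correction is \<open>F - G\<close> applied to the sampled value.
\<close>

definition sparareal_scheme ::
  "'w measure \<Rightarrow> nat \<Rightarrow> 'w propagator \<Rightarrow> 'w propagator \<Rightarrow> complex \<Rightarrow>
   (nat \<Rightarrow> nat \<Rightarrow> 'w \<Rightarrow> complex) \<Rightarrow> (nat \<Rightarrow> nat \<Rightarrow> 'w \<Rightarrow> complex) \<Rightarrow> bool" where
  "sparareal_scheme M N F G u0 U S \<longleftrightarrow> (\<forall>\<omega>\<in>space M.
     (\<forall>k. U k 0 \<omega> = u0) \<and>
     (\<forall>n<N. U 0 (Suc n) \<omega> = G n \<omega> (U 0 n \<omega>)) \<and>
     (\<forall>k. \<forall>n<N. U (Suc k) (Suc n) \<omega> =
        G n \<omega> (U (Suc k) n \<omega>) + (F n \<omega> (S k n \<omega>) - G n \<omega> (S k n \<omega>))) \<and>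
     (\<forall>n<N. S 0 n \<omega> = U 0 n \<omega>) \<and>
     (\<forall>k. S k 0 \<omega> = u0))"

text \<open>Only meaningful for \<open>k \<ge> 1\<close> and \<open>n \<ge> 1\<close>.\<close>

definition sampling_sd ::
  "'w propagator \<Rightarrow> (nat \<Rightarrow> nat \<Rightarrow> 'w \<Rightarrow> complex) \<Rightarrow> nat \<Rightarrow> nat \<Rightarrow> 'w \<Rightarrow> real" where
  "sampling_sd G U k n \<omega> =
     cmod (G (n - 1) \<omega> (U k (n - 1) \<omega>) - G (n - 1) \<omega> (U (k - 1) (n - 1) \<omega>))"

text \<open>
  The sampling variables are indexed by pairs \<open>(k, n)\<close> with \<open>k \<ge> 1\<close> and
  \<open>1 \<le> n \<le> N - 1\<close>, exactly those entering the scheme.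
\<close>

definition sampling_rule_2 ::
  "'w measure \<Rightarrow> real \<Rightarrow> nat \<Rightarrow> (real \<Rightarrow> 'w \<Rightarrow> real) \<Rightarrow> 'w propagator \<Rightarrow>
   (nat \<Rightarrow> nat \<Rightarrow> 'w \<Rightarrow> complex) \<Rightarrow> (nat \<Rightarrow> nat \<Rightarrow> 'w \<Rightarrow> complex) \<Rightarrow> bool" where
  "sampling_rule_2 M T N W G U S \<longleftrightarrow> (\<exists>z :: nat \<times> nat \<Rightarrow> 'w \<Rightarrow> real.
     indep_noise M T W ({1..} \<times> {1..<N}) z \<and>
     (\<forall>i \<in> {1..} \<times> {1..<N}. distributed M lborel (z i) std_normal_density) \<and>
     (\<forall>k\<in>{1..}. \<forall>n\<in>{1..<N}. \<forall>\<omega>\<in>space M.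
        S k n \<omega> = U k n \<omega> + of_real (sampling_sd G U k n \<omega> * z (k, n) \<omega>)))"

definition sampling_rule_4 ::
  "'w measure \<Rightarrow> real \<Rightarrow> nat \<Rightarrow> (real \<Rightarrow> 'w \<Rightarrow> real) \<Rightarrow> 'w propagator \<Rightarrow>
   (nat \<Rightarrow> nat \<Rightarrow> 'w \<Rightarrow> complex) \<Rightarrow> (nat \<Rightarrow> nat \<Rightarrow> 'w \<Rightarrow> complex) \<Rightarrow> bool" where
  "sampling_rule_4 M T N W G U S \<longleftrightarrow> (\<exists>r :: nat \<times> nat \<Rightarrow> 'w \<Rightarrow> real.
     indep_noise M T W ({1..} \<times> {1..<N}) r \<and>
     (\<forall>i \<in> {1..} \<times> {1..<N}. distr M lborel (r i) = uniform_measure lborel {0..1}) \<and>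
     (\<forall>k\<in>{1..}. \<forall>n\<in>{1..<N}. \<forall>\<omega>\<in>space M.
        S k n \<omega> = U k n \<omega> + of_real (sqrt 3 * sampling_sd G U k n \<omega> * (2 * r (k, n) \<omega> - 1))))"

definition mean_square_error :: "'w measure \<Rightarrow> ('w \<Rightarrow> complex) \<Rightarrow> ('w \<Rightarrow> complex) \<Rightarrow> real" where
  "mean_square_error M X Y = (\<integral>\<omega>. (cmod (X \<omega> - Y \<omega>))\<^sup>2 \<partial>M)"

end

theory Submission
  imports Defs
begin

text \<open>
  Subtract the fine recursion \<open>u (n + 1) = f n * u n\<close> from the scheme. Since both propagators are
  multiplications by random numbers \<open>f n\<close> and \<open>g n\<close>, the error of the iterates satisfies

    \<open>U (k + 1) (n + 1) - u (n + 1) = g n * (U (k + 1) n - u n) + (f n - g n) * (S k n - u n)\<close>.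

  The coefficients depend only on the Brownian increments over the \<open>n\<close>-th interval, the errors on the
  right only on earlier increments and on sampling variables, so the coefficients are independent of
  the errors. Expanding the mean square, the mixed term factors, and Young's inequality gives

    \<open>\<epsilon> (k + 1) (n + 1) \<le> (E[|g|\<^sup>2] + c) * \<epsilon> (k + 1) n + (E[|f - g|\<^sup>2] + c) * E[|S k n - u n|\<^sup>2]\<close>

  with \<open>c = |E[g * cnj (f - g)]|\<close> (lemma \<open>indep_linear_step_bound\<close>). Computing the moments from those
  of standard normal variables (lemma \<open>propagator_moments\<close>) identifies the two coefficients as \<open>\<alpha>\<close> and
  \<open>\<beta>\<close>.

  The sampled value is the iterate plus a standard deviation times a variable of unit second moment
  that is independent of this standard deviation. The mean square of the jump is therefore
  \<open>\<gamma> * E[|U k (n - 1) - U (k - 1) (n - 1)|\<^sup>2]\<close>, and comparing both iterates with the fine solution gives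

    \<open>E[|S k n - u n|\<^sup>2] \<le> 2 * \<epsilon> k n + 4 * \<gamma> * (\<epsilon> k (n - 1) + \<epsilon> (k - 1) (n - 1))\<close>.

  As \<open>\<alpha> < 1\<close>, the recursion in \<open>n\<close> is a contraction, and the suprema over \<open>n\<close> satisfy a linear two-step
  recursion in \<open>k\<close>; the number in brackets is the nonnegative root of its characteristic equation
  (lemma \<open>sup_error_geometric_bound\<close>).

  To make the independence arguments precise, the scheme is first rephrased for one independent family
  of real variables that contains the normalized fine increments and the sampling variables (locale
  \<open>parareal_error\<close>). An induction along the scheme records, for each iterate, a set of indices on which
  it depends, together with its square integrability (lemma \<open>U_sq\<close>).
\<close>

section \<open>Independent square integrable variables\<close>

text \<open>
  The information carried by the variables \<open>X i\<close>, \<open>i \<in> J\<close>. It is generated by preimages under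
  the single variables, not by the joint map into a product space, so that enlarging \<open>J\<close> only adds
  generators and all index sets share one underlying space.
\<close>

definition noise_algebra :: "'w measure \<Rightarrow> ('i \<Rightarrow> 'w \<Rightarrow> real) \<Rightarrow> 'i set \<Rightarrow> 'w measure" where
  "noise_algebra M X J = sigma (space M) (\<Union>i\<in>J. {X i -` A \<inter> space M |A. A \<in> sets borel})"

lemma space_noise_algebra [simp]: "space (noise_algebra M X J) = space M"
  unfolding noise_algebra_def by (rule space_measure_of) auto

lemma sets_noise_algebra:
  "sets (noise_algebra M X J) =
    sigma_sets (space M) (\<Union>i\<in>J. {X i -` A \<inter> space M |A. A \<in> sets borel})"
  unfolding noise_algebra_def by (rule sets_measure_of) auto

lemma subalgebra_noise_algebra:
  assumes "\<And>i. i \<in> J \<Longrightarrow> X i \<in> borel_measurable M"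
  shows "subalgebra M (noise_algebra M X J)"
  unfolding subalgebra_def sets_noise_algebra
  using assms by (auto intro!: sets.sigma_sets_subset simp: measurable_sets)

lemma measurable_noise_algebra_member:
  "i \<in> J \<Longrightarrow> X i \<in> borel_measurable (noise_algebra M X J)"
  by (rule measurableI) (auto simp: sets_noise_algebra intro!: sigma_sets.Basic)

lemma measurable_noise_algebra_mono:
  assumes "J \<subseteq> K" "Y \<in> noise_algebra M X J \<rightarrow>\<^sub>M R"
  shows "Y \<in> noise_algebra M X K \<rightarrow>\<^sub>M R"
proof (rule measurable_mono[THEN subsetD, OF _ _ _ _ assms(2)])
  show "sets (noise_algebra M X J) \<subseteq> sets (noise_algebra M X K)"
    unfolding sets_noise_algebra using assms(1) by (intro sigma_sets_mono') auto
qed auto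

lemma norm_add_square_le: "(cmod (x + y))\<^sup>2 \<le> 2 * (cmod x)\<^sup>2 + 2 * (cmod y)\<^sup>2"
proof -
  have "(cmod (x + y))\<^sup>2 \<le> (cmod x + cmod y)\<^sup>2"
    by (intro power_mono norm_triangle_ineq) simp
  also have "\<dots> \<le> 2 * (cmod x)\<^sup>2 + 2 * (cmod y)\<^sup>2"
    using sum_squares_bound[of "cmod x" "cmod y"] by (simp add: power2_sum)
  finally show ?thesis .
qed

lemma borel_measurable_cnj [measurable]:
  "f \<in> borel_measurable F \<Longrightarrow> (\<lambda>x. cnj (f x)) \<in> borel_measurable F"
  by (erule borel_measurable_continuous_on[rotated]) (intro continuous_intros)

context prob_space
begin

text \<open>
  The preimages under one variable are closed under intersection, so independence of the family
  passes to the \<open>\<sigma>\<close>-algebras generated by disjoint blocks of it. The error analysis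
  uses it with two blocks: the noise of one time step, or a single sampling variable, against everything drawn before.
\<close>

lemma indep_noise_algebras:
  assumes ind: "indep_vars (\<lambda>_. borel) X I" and "J \<subseteq> I" "K \<subseteq> I" "J \<inter> K = {}"
  shows "indep_set (sets (noise_algebra M X J)) (sets (noise_algebra M X K))"
proof -
  let ?E = "\<lambda>i. {X i -` A \<inter> space M |A. A \<in> sets (borel :: real measure)}"
  have "indep_sets ?E I"
    using ind unfolding indep_vars_def2 by simp
  then have "indep_sets ?E (\<Union>b. case_bool J K b)"
    by (rule indep_sets_mono_index[rotated]) (use assms in \<open>auto split: bool.splits\<close>)
  then have "indep_sets (\<lambda>b. sigma_sets (space M) (\<Union>i\<in>case_bool J K b. ?E i)) UNIV"
  proof (rule indep_sets_collect_sigma)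
    fix i
    show "Int_stable (?E i)"
    proof (rule Int_stableI, safe)
      fix A B :: "real set" assume "A \<in> sets borel" "B \<in> sets borel"
      then show "\<exists>C. (X i -` A \<inter> space M) \<inter> (X i -` B \<inter> space M) = X i -` C \<inter> space M
          \<and> C \<in> sets borel"
        by (intro exI[of _ "A \<inter> B"]) auto
    qed
    show "disjoint_family_on (case_bool J K) UNIV"
      using assms(4) by (auto simp: disjoint_family_on_def split: bool.splits)
  qed
  moreover have "(\<lambda>b. sigma_sets (space M) (\<Union>i\<in>case_bool J K b. ?E i))
      = case_bool (sets (noise_algebra M X J)) (sets (noise_algebra M X K))"
    by (rule ext) (simp add: sets_noise_algebra split: bool.splits)
  ultimately show ?thesis
    unfolding indep_set_def by simp
qed

lemma indep_var_from_algebras: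
  assumes ind: "indep_set (sets F) (sets H)" and sp: "space F = space M" "space H = space M"
    and Y: "Y \<in> F \<rightarrow>\<^sub>M R" and Z: "Z \<in> H \<rightarrow>\<^sub>M (R' :: 'b measure)"
  shows "indep_var R Y R' Z"
proof -
  have sub: "sigma_sets (space M) {V -` A \<inter> space M |A. A \<in> sets R} \<subseteq> sets F"
    if V: "V \<in> F \<rightarrow>\<^sub>M R" and "space F = space M" for V F and R :: "'b measure"
  proof -
    have "{V -` A \<inter> space F |A. A \<in> sets R} \<subseteq> sets F"
      using measurable_sets[OF V] by blast
    from sets.sigma_sets_subset[OF this] show ?thesis
      using that(2) by simp
  qed
  have "indep_set (sigma_sets (space M) {Y -` A \<inter> space M |A. A \<in> sets R})
          (sigma_sets (space M) {Z -` A \<inter> space M |A. A \<in> sets R'})"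
    using ind sub[OF Y sp(1)] sub[OF Z sp(2)] unfolding indep_sets2_eq by (meson subset_iff subset_trans)
  moreover have "subalgebra M F" "subalgebra M H"
    using ind sp unfolding indep_sets2_eq subalgebra_def by auto
  then have "Y \<in> M \<rightarrow>\<^sub>M R" "Z \<in> M \<rightarrow>\<^sub>M R'"
    using measurable_from_subalg Y Z by blast+
  ultimately show ?thesis
    unfolding indep_var_eq by simp
qed

lemma expectation_mult_algebras:
  fixes Y Z :: "'a \<Rightarrow> 'b :: {real_normed_field, banach, second_countable_topology}"
  assumes "indep_set (sets F) (sets H)" "space F = space M" "space H = space M"
    and "Y \<in> borel_measurable F" "Z \<in> borel_measurable H" "integrable M Y" "integrable M Z"
  shows "integrable M (\<lambda>\<omega>. Y \<omega> * Z \<omega>)"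
    and "expectation (\<lambda>\<omega>. Y \<omega> * Z \<omega>) = expectation Y * expectation Z"
  using indep_var_integrable indep_var_lebesgue_integral
    indep_var_from_algebras[OF assms(1-5)] assms(6,7) by auto

text \<open>
  The \<open>\<sigma>\<close>-algebra \<open>F\<close> records which noise \<open>Y\<close> may depend on, while integrability always refers to
  the ambient probability space.
\<close>

definition sq_integrable :: "'a measure \<Rightarrow> ('a \<Rightarrow> complex) \<Rightarrow> bool" where
  "sq_integrable F Y \<longleftrightarrow>
     Y \<in> borel_measurable F \<and> integrable M (\<lambda>\<omega>. (cmod (Y \<omega>))\<^sup>2)"

lemma sq_integrable_add:
  assumes F: "subalgebra M F" and "sq_integrable F Y" "sq_integrable F Z"
  shows "sq_integrable F (\<lambda>\<omega>. Y \<omega> + Z \<omega>)"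
    and "expectation (\<lambda>\<omega>. (cmod (Y \<omega> + Z \<omega>))\<^sup>2)
       \<le> 2 * expectation (\<lambda>\<omega>. (cmod (Y \<omega>))\<^sup>2) + 2 * expectation (\<lambda>\<omega>. (cmod (Z \<omega>))\<^sup>2)"
proof -
  have [measurable]: "Y \<in> borel_measurable F" "Z \<in> borel_measurable F"
    and int [simp]: "integrable M (\<lambda>\<omega>. (cmod (Y \<omega>))\<^sup>2)" "integrable M (\<lambda>\<omega>. (cmod (Z \<omega>))\<^sup>2)"
    using assms unfolding sq_integrable_def by auto
  have *: "integrable M (\<lambda>\<omega>. (cmod (Y \<omega> + Z \<omega>))\<^sup>2)"
  proof (rule Bochner_Integration.integrable_bound)
    show "integrable M (\<lambda>\<omega>. 2 * (cmod (Y \<omega>))\<^sup>2 + 2 * (cmod (Z \<omega>))\<^sup>2)" by simp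
    show "(\<lambda>\<omega>. (cmod (Y \<omega> + Z \<omega>))\<^sup>2) \<in> borel_measurable M"
      by (rule measurable_from_subalg[OF F]) measurable
  qed (auto simp: norm_add_square_le)
  then show "sq_integrable F (\<lambda>\<omega>. Y \<omega> + Z \<omega>)"
    unfolding sq_integrable_def by simp
  have "expectation (\<lambda>\<omega>. (cmod (Y \<omega> + Z \<omega>))\<^sup>2)
      \<le> expectation (\<lambda>\<omega>. 2 * (cmod (Y \<omega>))\<^sup>2 + 2 * (cmod (Z \<omega>))\<^sup>2)"
    by (intro integral_mono *) (auto simp: norm_add_square_le)
  then show "expectation (\<lambda>\<omega>. (cmod (Y \<omega> + Z \<omega>))\<^sup>2)
       \<le> 2 * expectation (\<lambda>\<omega>. (cmod (Y \<omega>))\<^sup>2) + 2 * expectation (\<lambda>\<omega>. (cmod (Z \<omega>))\<^sup>2)"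
    by simp
qed

lemma sq_integrable_diff:
  assumes F: "subalgebra M F" and "sq_integrable F Y" "sq_integrable F Z"
  shows "sq_integrable F (\<lambda>\<omega>. Y \<omega> - Z \<omega>)"
    and "expectation (\<lambda>\<omega>. (cmod (Y \<omega> - Z \<omega>))\<^sup>2)
       \<le> 2 * expectation (\<lambda>\<omega>. (cmod (Y \<omega>))\<^sup>2) + 2 * expectation (\<lambda>\<omega>. (cmod (Z \<omega>))\<^sup>2)"
proof -
  have "sq_integrable F (\<lambda>\<omega>. - Z \<omega>)"
    using assms(3) unfolding sq_integrable_def by simp
  from sq_integrable_add[OF F assms(2) this]
  show "sq_integrable F (\<lambda>\<omega>. Y \<omega> - Z \<omega>)"
    and "expectation (\<lambda>\<omega>. (cmod (Y \<omega> - Z \<omega>))\<^sup>2)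
       \<le> 2 * expectation (\<lambda>\<omega>. (cmod (Y \<omega>))\<^sup>2) + 2 * expectation (\<lambda>\<omega>. (cmod (Z \<omega>))\<^sup>2)"
    by simp_all
qed

lemma sq_integrable_mono:
  "sq_integrable (noise_algebra M X J) Y \<Longrightarrow> J \<subseteq> K \<Longrightarrow> sq_integrable (noise_algebra M X K) Y"
  unfolding sq_integrable_def using measurable_noise_algebra_mono by blast

text \<open>
  A product of two square integrable factors is in general only integrable; independence keeps it
  square integrable. This is what lets square integrability propagate along the scheme, where
  iterates are multiplied by random propagators.
\<close>

lemma sq_integrable_mult_indep:
  assumes "indep_set (sets (noise_algebra M X J)) (sets (noise_algebra M X K))"
    and "sq_integrable (noise_algebra M X J) Y" "sq_integrable (noise_algebra M X K) Z"
  shows "sq_integrable (noise_algebra M X (J \<union> K)) (\<lambda>\<omega>. Y \<omega> * Z \<omega>)"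
    and "expectation (\<lambda>\<omega>. (cmod (Y \<omega> * Z \<omega>))\<^sup>2) =
      expectation (\<lambda>\<omega>. (cmod (Y \<omega>))\<^sup>2) * expectation (\<lambda>\<omega>. (cmod (Z \<omega>))\<^sup>2)"
proof -
  have [measurable]: "Y \<in> borel_measurable (noise_algebra M X J)"
      "Z \<in> borel_measurable (noise_algebra M X K)"
    and int [simp]: "integrable M (\<lambda>\<omega>. (cmod (Y \<omega>))\<^sup>2)" "integrable M (\<lambda>\<omega>. (cmod (Z \<omega>))\<^sup>2)"
    using assms(2,3) unfolding sq_integrable_def by auto
  have [measurable]: "Y \<in> borel_measurable (noise_algebra M X (J \<union> K))"
      "Z \<in> borel_measurable (noise_algebra M X (J \<union> K))"
    by (auto intro: measurable_noise_algebra_mono[of J] measurable_noise_algebra_mono[of K])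
  note prods = expectation_mult_algebras[OF assms(1) _ _ _ _ int]
  have "(\<lambda>\<omega>. Y \<omega> * Z \<omega>) \<in> borel_measurable (noise_algebra M X (J \<union> K))" by measurable
  moreover have "integrable M (\<lambda>\<omega>. (cmod (Y \<omega>))\<^sup>2 * (cmod (Z \<omega>))\<^sup>2)"
    by (rule prods) simp_all
  ultimately show "sq_integrable (noise_algebra M X (J \<union> K)) (\<lambda>\<omega>. Y \<omega> * Z \<omega>)"
    unfolding sq_integrable_def by (simp add: norm_mult power_mult_distrib)
  have "expectation (\<lambda>\<omega>. (cmod (Y \<omega>))\<^sup>2 * (cmod (Z \<omega>))\<^sup>2)
      = expectation (\<lambda>\<omega>. (cmod (Y \<omega>))\<^sup>2) * expectation (\<lambda>\<omega>. (cmod (Z \<omega>))\<^sup>2)"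
    by (rule prods) simp_all
  then show "expectation (\<lambda>\<omega>. (cmod (Y \<omega> * Z \<omega>))\<^sup>2) =
      expectation (\<lambda>\<omega>. (cmod (Y \<omega>))\<^sup>2) * expectation (\<lambda>\<omega>. (cmod (Z \<omega>))\<^sup>2)"
    by (simp add: norm_mult power_mult_distrib)
qed

lemma integrable_mult_cnj:
  assumes F: "subalgebra M F" and "sq_integrable F Y" "sq_integrable F Z"
  shows "integrable M (\<lambda>\<omega>. Y \<omega> * cnj (Z \<omega>))"
    and "cmod (expectation (\<lambda>\<omega>. Y \<omega> * cnj (Z \<omega>)))
      \<le> (expectation (\<lambda>\<omega>. (cmod (Y \<omega>))\<^sup>2) + expectation (\<lambda>\<omega>. (cmod (Z \<omega>))\<^sup>2)) / 2"
proof -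
  have [measurable]: "Y \<in> borel_measurable F" "Z \<in> borel_measurable F"
    and int [simp]: "integrable M (\<lambda>\<omega>. (cmod (Y \<omega>))\<^sup>2)" "integrable M (\<lambda>\<omega>. (cmod (Z \<omega>))\<^sup>2)"
    using assms unfolding sq_integrable_def by auto
  have young: "cmod x * cmod y \<le> ((cmod x)\<^sup>2 + (cmod y)\<^sup>2) / 2" for x y :: complex
    using sum_squares_bound[of "cmod x" "cmod y"] by (simp add: ac_simps)
  show *: "integrable M (\<lambda>\<omega>. Y \<omega> * cnj (Z \<omega>))"
  proof (rule Bochner_Integration.integrable_bound)
    show "integrable M (\<lambda>\<omega>. ((cmod (Y \<omega>))\<^sup>2 + (cmod (Z \<omega>))\<^sup>2) / 2)" by simp
    show "(\<lambda>\<omega>. Y \<omega> * cnj (Z \<omega>)) \<in> borel_measurable M"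
      by (rule measurable_from_subalg[OF F]) measurable
  qed (use young in \<open>auto simp: norm_mult simp del: le_divide_eq_numeral1 intro!: AE_I2\<close>)
  have "cmod (expectation (\<lambda>\<omega>. Y \<omega> * cnj (Z \<omega>))) \<le> expectation (\<lambda>\<omega>. cmod (Y \<omega> * cnj (Z \<omega>)))"
    by (rule integral_norm_bound)
  also have "\<dots> \<le> expectation (\<lambda>\<omega>. ((cmod (Y \<omega>))\<^sup>2 + (cmod (Z \<omega>))\<^sup>2) / 2)"
    by (intro integral_mono integrable_norm *) (auto simp: norm_mult young simp del: le_divide_eq_numeral1)
  finally show "cmod (expectation (\<lambda>\<omega>. Y \<omega> * cnj (Z \<omega>)))
      \<le> (expectation (\<lambda>\<omega>. (cmod (Y \<omega>))\<^sup>2) + expectation (\<lambda>\<omega>. (cmod (Z \<omega>))\<^sup>2)) / 2"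
    by simp
qed

lemma expectation_norm_add_square:
  assumes F: "subalgebra M F" and "sq_integrable F Y" "sq_integrable F Z"
  shows "expectation (\<lambda>\<omega>. (cmod (Y \<omega> + Z \<omega>))\<^sup>2)
    = expectation (\<lambda>\<omega>. (cmod (Y \<omega>))\<^sup>2) + expectation (\<lambda>\<omega>. (cmod (Z \<omega>))\<^sup>2)
      + 2 * Re (expectation (\<lambda>\<omega>. Y \<omega> * cnj (Z \<omega>)))"
proof -
  have int [simp]: "integrable M (\<lambda>\<omega>. (cmod (Y \<omega>))\<^sup>2)" "integrable M (\<lambda>\<omega>. (cmod (Z \<omega>))\<^sup>2)"
      "integrable M (\<lambda>\<omega>. Y \<omega> * cnj (Z \<omega>))"
    using assms integrable_mult_cnj[OF assms] unfolding sq_integrable_def by auto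
  have "(cmod (x + y))\<^sup>2 = (cmod x)\<^sup>2 + (cmod y)\<^sup>2 + 2 * Re (x * cnj y)" for x y
    unfolding cmod_power2 by (simp add: power2_eq_square algebra_simps)
  then have "expectation (\<lambda>\<omega>. (cmod (Y \<omega> + Z \<omega>))\<^sup>2)
      = expectation (\<lambda>\<omega>. (cmod (Y \<omega>))\<^sup>2 + (cmod (Z \<omega>))\<^sup>2 + 2 * Re (Y \<omega> * cnj (Z \<omega>)))"
    by (simp only:)
  also have "\<dots> = expectation (\<lambda>\<omega>. (cmod (Y \<omega>))\<^sup>2) + expectation (\<lambda>\<omega>. (cmod (Z \<omega>))\<^sup>2)
      + 2 * expectation (\<lambda>\<omega>. Re (Y \<omega> * cnj (Z \<omega>)))"
    using integrable_Re[OF int(3)] by (simp del: times_complex.sel)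
  finally show ?thesis
    by (simp only: integral_Re[OF int(3)])
qed

text \<open>
  One step of the error propagation. Since the random coefficients \<open>g\<close>, \<open>d\<close> are independent of the
  data \<open>e\<close>, \<open>s\<close>, the mixed term factors as \<open>E[g cnj d] * E[e cnj s]\<close>, and Young's inequality splits
  the second factor evenly between the mean squares of \<open>e\<close> and \<open>s\<close>. This is the origin of the modulus
  that appears both in \<open>\<alpha>\<close> and in \<open>\<beta>\<close>.
\<close>

lemma indep_linear_step_bound:
  assumes J: "\<And>i. i \<in> J \<Longrightarrow> X i \<in> borel_measurable M" and K: "\<And>i. i \<in> K \<Longrightarrow> X i \<in> borel_measurable M"
    and ind: "indep_set (sets (noise_algebra M X J)) (sets (noise_algebra M X K))"
    and g: "sq_integrable (noise_algebra M X J) g" and d: "sq_integrable (noise_algebra M X J) d"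
    and e: "sq_integrable (noise_algebra M X K) e" and s: "sq_integrable (noise_algebra M X K) s"
  defines "c \<equiv> cmod (expectation (\<lambda>\<omega>. g \<omega> * cnj (d \<omega>)))"
  shows "expectation (\<lambda>\<omega>. (cmod (g \<omega> * e \<omega> + d \<omega> * s \<omega>))\<^sup>2)
    \<le> (expectation (\<lambda>\<omega>. (cmod (g \<omega>))\<^sup>2) + c) * expectation (\<lambda>\<omega>. (cmod (e \<omega>))\<^sup>2)
     + (expectation (\<lambda>\<omega>. (cmod (d \<omega>))\<^sup>2) + c) * expectation (\<lambda>\<omega>. (cmod (s \<omega>))\<^sup>2)"
proof -
  let ?F = "noise_algebra M X"
  have sJ: "subalgebra M (?F J)" and sK: "subalgebra M (?F K)" and sJK: "subalgebra M (?F (J \<union> K))"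
    by (rule subalgebra_noise_algebra, use J K in blast)+
  note ge = sq_integrable_mult_indep[OF ind g e] and ds = sq_integrable_mult_indep[OF ind d s]
  have [measurable]: "g \<in> borel_measurable (?F J)" "d \<in> borel_measurable (?F J)"
      "e \<in> borel_measurable (?F K)" "s \<in> borel_measurable (?F K)"
    using g d e s unfolding sq_integrable_def by auto
  have cross: "expectation (\<lambda>\<omega>. (g \<omega> * e \<omega>) * cnj (d \<omega> * s \<omega>))
      = expectation (\<lambda>\<omega>. g \<omega> * cnj (d \<omega>)) * expectation (\<lambda>\<omega>. e \<omega> * cnj (s \<omega>))"
  proof -
    have "(\<lambda>\<omega>. g \<omega> * cnj (d \<omega>)) \<in> borel_measurable (?F J)"
        "(\<lambda>\<omega>. e \<omega> * cnj (s \<omega>)) \<in> borel_measurable (?F K)"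
      by measurable
    from expectation_mult_algebras(2)[OF ind _ _ this integrable_mult_cnj(1)[OF sJ g d]
        integrable_mult_cnj(1)[OF sK e s]]
    show ?thesis by (simp add: ac_simps)
  qed
  have "Re (expectation (\<lambda>\<omega>. g \<omega> * cnj (d \<omega>)) * expectation (\<lambda>\<omega>. e \<omega> * cnj (s \<omega>)))
      \<le> c * cmod (expectation (\<lambda>\<omega>. e \<omega> * cnj (s \<omega>)))"
    unfolding c_def norm_mult[symmetric] by (rule complex_Re_le_cmod)
  also have "\<dots> \<le> c * ((expectation (\<lambda>\<omega>. (cmod (e \<omega>))\<^sup>2) + expectation (\<lambda>\<omega>. (cmod (s \<omega>))\<^sup>2)) / 2)"
    by (intro mult_left_mono integrable_mult_cnj(2)[OF sK e s]) (simp add: c_def)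
  finally have "2 * Re (expectation (\<lambda>\<omega>. (g \<omega> * e \<omega>) * cnj (d \<omega> * s \<omega>)))
      \<le> c * expectation (\<lambda>\<omega>. (cmod (e \<omega>))\<^sup>2) + c * expectation (\<lambda>\<omega>. (cmod (s \<omega>))\<^sup>2)"
    unfolding cross by (simp add: algebra_simps)
  with expectation_norm_add_square[OF sJK ge(1) ds(1)] show ?thesis
    unfolding ge(2) ds(2) by (simp add: algebra_simps)
qed

end

section \<open>A two-step recursion for suprema\<close>

text \<open>
  The bound \<open>D / (1 - \<alpha>)\<close> is the fixed point of \<open>x \<mapsto> \<alpha> x + D\<close>, and this map is
  monotone, so a sequence that starts below the fixed point stays below it.
\<close>

lemma affine_recursion_bound:
  fixes x :: "nat \<Rightarrow> real"
  assumes "0 \<le> \<alpha>" "\<alpha> < 1" "0 \<le> D" "x 0 \<le> 0"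
    and step: "\<And>n. n < N \<Longrightarrow> x (Suc n) \<le> \<alpha> * x n + D"
    and "n \<le> N"
  shows "x n \<le> D / (1 - \<alpha>)"
  using \<open>n \<le> N\<close>
proof (induction n)
  case 0
  then show ?case using assms by (auto intro: order_trans)
next
  case (Suc n)
  have "x (Suc n) \<le> \<alpha> * x n + D"
    using step Suc.prems by simp
  also have "\<dots> \<le> \<alpha> * (D / (1 - \<alpha>)) + D"
    using Suc assms(1) by (intro add_mono mult_left_mono) auto
  also have "\<dots> = D / (1 - \<alpha>)"
    using \<open>\<alpha> < 1\<close> by (simp add: field_simps)
  finally show ?case .
qed

text \<open>
  Read \<open>e k n\<close> as the error of the iterate and \<open>s k n\<close> as the error of the sampled value. Bounding
  the sampled errors of one iteration uniformly in \<open>n\<close> turns the first inequality into an affine recursion in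
  \<open>n\<close>, so the suprema satisfy \<open>E (k + 2) \<le> P * E (k + 1) + Q * E k\<close>. The number whose powers bound \<open>E\<close>
  is the nonnegative root of \<open>r\<^sup>2 = P * r + Q\<close>, the growth rate of this recursion. In the first
  iteration nothing is sampled, and \<open>E 1 \<le> P * E 0\<close>; since \<open>P \<le> r\<close>, induction applies.
\<close>

lemma sup_error_geometric_bound:
  fixes e s :: "nat \<Rightarrow> nat \<Rightarrow> real" and P Q :: real
  assumes coeffs: "0 \<le> \<alpha>" "\<alpha> < 1" "0 \<le> \<beta>" "0 \<le> \<gamma>"
    and e_nonneg: "\<And>k n. 0 \<le> e k n" and e_0: "\<And>k. e k 0 = 0"
    and step: "\<And>k n. n < N \<Longrightarrow> e (Suc k) (Suc n) \<le> \<alpha> * e (Suc k) n + \<beta> * s k n"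
    and s_init: "\<And>n. n < N \<Longrightarrow> s 0 n \<le> e 0 n"
    and s_start: "\<And>k. s (Suc k) 0 \<le> 0"
    and s_step: "\<And>k n. Suc n < N \<Longrightarrow>
        s (Suc k) (Suc n) \<le> 2 * e (Suc k) (Suc n) + 4 * \<gamma> * (e (Suc k) n + e k n)"
  defines "P \<equiv> 2 * \<beta> * (1 + 2 * \<gamma>) / (1 - \<alpha>)" and "Q \<equiv> 4 * \<beta> * \<gamma> / (1 - \<alpha>)"
  shows "(SUP n\<in>{0..N}. e k n) \<le> (SUP n\<in>{0..N}. e 0 n) * ((P + sqrt (P\<^sup>2 + 4 * Q)) / 2) ^ k"
proof -
  define E where "E k = (SUP n\<in>{0..N}. e k n)" for k
  define r where "r = (P + sqrt (P\<^sup>2 + 4 * Q)) / 2"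
  have le_E: "e k n \<le> E k" if "n \<le> N" for k n
    unfolding E_def by (rule cSUP_upper) (use that in auto)
  have E_le: "E k \<le> C" if "\<And>n. n \<le> N \<Longrightarrow> e k n \<le> C" for k C
    unfolding E_def by (rule cSUP_least) (use that in auto)
  have E_nonneg: "0 \<le> E k" for k
    using le_E[of 0 k] e_0[of k] by simp
  have PQ: "0 \<le> P" "0 \<le> Q"
    using coeffs by (simp_all add: P_def Q_def)
  have "P \<le> sqrt (P\<^sup>2 + 4 * Q)"
    using PQ by (intro real_le_rsqrt) simp
  then have r: "P \<le> r" "0 \<le> r"
    using PQ by (simp_all add: r_def)
  have r_root: "r\<^sup>2 = P * r + Q"
  proof -
    have "(2 * r - P)\<^sup>2 = P\<^sup>2 + 4 * Q"
      unfolding r_def using PQ by (simp add: diff_divide_distrib[symmetric] add_divide_distrib)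
    then show ?thesis by (simp add: power2_eq_square algebra_simps)
  qed
  have first: "E 1 \<le> P * E 0"
  proof (rule E_le)
    fix n assume "n \<le> N"
    have "e 1 n \<le> \<beta> * E 0 / (1 - \<alpha>)"
    proof (rule affine_recursion_bound[OF coeffs(1,2) _ _ _ \<open>n \<le> N\<close>])
      fix n assume n: "n < N"
      have "s 0 n \<le> E 0"
        using s_init[OF n] le_E[of n 0] n by simp
      then show "e 1 (Suc n) \<le> \<alpha> * e 1 n + \<beta> * E 0"
        using step[OF n, of 0] mult_left_mono[of "s 0 n" "E 0" \<beta>] coeffs by simp
    qed (use coeffs E_nonneg e_0 in auto)
    also have "\<dots> \<le> P * E 0"
    proof -
      have "\<beta> * E 0 \<le> 2 * \<beta> * (1 + 2 * \<gamma>) * E 0"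
        using coeffs E_nonneg[of 0] mult_nonneg_nonneg[of "\<beta> * E 0" \<gamma>]
          mult_nonneg_nonneg[of \<beta> "E 0"]
        by (simp add: algebra_simps)
      then show ?thesis
        using coeffs by (simp add: P_def divide_right_mono)
    qed
    finally show "e 1 n \<le> P * E 0" .
  qed
  have later: "E (Suc (Suc k)) \<le> P * E (Suc k) + Q * E k" for k
  proof (rule E_le)
    fix n assume "n \<le> N"
    \<comment> \<open>\<open>?D\<close> bounds the sampled errors of iteration \<open>k + 1\<close> uniformly in \<open>n\<close>.\<close>
    let ?D = "2 * (1 + 2 * \<gamma>) * E (Suc k) + 4 * \<gamma> * E k"
    have D: "0 \<le> ?D" using coeffs E_nonneg by simp
    have "e (Suc (Suc k)) n \<le> \<beta> * ?D / (1 - \<alpha>)"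
    proof (rule affine_recursion_bound[OF coeffs(1,2) _ _ _ \<open>n \<le> N\<close>])
      fix n assume n: "n < N"
      have "s (Suc k) n \<le> ?D"
      proof (cases n)
        case 0
        then show ?thesis using s_start[of k] D by simp
      next
        case (Suc m)
        have "\<gamma> * (e (Suc k) m + e k m) \<le> \<gamma> * (E (Suc k) + E k)"
          using n Suc coeffs by (intro mult_left_mono add_mono le_E) auto
        then show ?thesis
          using s_step[of m k] n Suc le_E[of n "Suc k"] by (simp add: algebra_simps)
      qed
      then show "e (Suc (Suc k)) (Suc n) \<le> \<alpha> * e (Suc (Suc k)) n + \<beta> * ?D"
        using step[OF n, of "Suc k"] mult_left_mono[of "s (Suc k) n" ?D \<beta>] coeffs by simp
    qed (use coeffs D e_0 in auto)
    also have "\<dots> = P * E (Suc k) + Q * E k"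
      by (simp add: P_def Q_def add_divide_distrib algebra_simps)
    finally show "e (Suc (Suc k)) n \<le> P * E (Suc k) + Q * E k" .
  qed
  have "E k \<le> E 0 * r ^ k"
  proof (induction k rule: induct_nat_012)
    case 1
    have "P * E 0 \<le> r * E 0" using r E_nonneg by (intro mult_right_mono)
    with first show ?case by (simp add: mult.commute)
  next
    case (ge2 k)
    have "E (Suc (Suc k)) \<le> P * E (Suc k) + Q * E k" by (rule later)
    also have "\<dots> \<le> P * (E 0 * r ^ Suc k) + Q * (E 0 * r ^ k)"
      by (intro add_mono mult_left_mono ge2 PQ)
    also have "\<dots> = E 0 * r ^ k * (P * r + Q)" by (simp add: algebra_simps)
    also have "\<dots> = E 0 * r ^ Suc (Suc k)"
      unfolding r_root[symmetric] by (simp add: power2_eq_square)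
    finally show ?case .
  qed simp
  then show ?thesis unfolding E_def r_def .
qed

section \<open>Error recursion of the randomized iteration\<close>

text \<open>
  The scheme in a form that no longer mentions the Wiener process. All randomness is one independent
  family \<open>X\<close>: \<open>Inl i\<close> indexes the normalized increment over the \<open>i\<close>-th fine step, so that coarse
  interval \<open>n\<close> owns the indices \<open>2 * n\<close> and \<open>2 * n + 1\<close>, and \<open>Inr (k, n)\<close> indexes the sampling variable
  of iteration \<open>k\<close> at time \<open>n\<close>. The propagators act by multiplication with \<open>f n\<close> and \<open>g n\<close>. The function
  \<open>\<phi>\<close> turns a raw sampling variable into one of unit second moment, which covers both sampling rules:
  \<open>\<phi>\<close> is the identity for normal variables and \<open>v \<mapsto> sqrt 3 * (2 * v - 1)\<close> for uniform ones.
\<close>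

locale parareal_error = prob_space M for M :: "'w measure" +
  fixes X :: "nat + nat \<times> nat \<Rightarrow> 'w \<Rightarrow> real" and N :: nat
    and f g :: "nat \<Rightarrow> 'w \<Rightarrow> complex" and \<phi> :: "real \<Rightarrow> real" and u0 :: complex
    and u :: "nat \<Rightarrow> 'w \<Rightarrow> complex" and U S :: "nat \<Rightarrow> nat \<Rightarrow> 'w \<Rightarrow> complex"
    and \<gamma> \<delta> c :: real
  assumes indep: "indep_vars (\<lambda>_. borel) X (Inl ` {..<2 * N} \<union> Inr ` ({1..} \<times> {1..<N}))"
    and f_sq: "n < N \<Longrightarrow> sq_integrable (noise_algebra M X {Inl (2 * n), Inl (2 * n + 1)}) (f n)"
    and g_sq: "n < N \<Longrightarrow> sq_integrable (noise_algebra M X {Inl (2 * n), Inl (2 * n + 1)}) (g n)"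
    and g_moment: "n < N \<Longrightarrow> expectation (\<lambda>\<omega>. (cmod (g n \<omega>))\<^sup>2) = \<gamma>"
    and d_moment: "n < N \<Longrightarrow> expectation (\<lambda>\<omega>. (cmod (f n \<omega> - g n \<omega>))\<^sup>2) = \<delta>"
    and gd_moment: "n < N \<Longrightarrow> cmod (expectation (\<lambda>\<omega>. g n \<omega> * cnj (f n \<omega> - g n \<omega>))) = c"
    and \<phi>_borel: "\<phi> \<in> borel_measurable borel"
    and sample_sq: "p \<in> {1..} \<times> {1..<N} \<Longrightarrow> integrable M (\<lambda>\<omega>. (\<phi> (X (Inr p) \<omega>))\<^sup>2)"
    and sample_var: "p \<in> {1..} \<times> {1..<N} \<Longrightarrow> expectation (\<lambda>\<omega>. (\<phi> (X (Inr p) \<omega>))\<^sup>2) = 1"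
    and u_0: "\<omega> \<in> space M \<Longrightarrow> u 0 \<omega> = u0"
    and u_Suc: "\<omega> \<in> space M \<Longrightarrow> n < N \<Longrightarrow> u (Suc n) \<omega> = f n \<omega> * u n \<omega>"
    and U_0: "\<omega> \<in> space M \<Longrightarrow> U k 0 \<omega> = u0"
    and U_init: "\<omega> \<in> space M \<Longrightarrow> n < N \<Longrightarrow> U 0 (Suc n) \<omega> = g n \<omega> * U 0 n \<omega>"
    and U_Suc: "\<omega> \<in> space M \<Longrightarrow> n < N \<Longrightarrow>
      U (Suc k) (Suc n) \<omega> = g n \<omega> * U (Suc k) n \<omega> + (f n \<omega> - g n \<omega>) * S k n \<omega>"
    and S_init: "\<omega> \<in> space M \<Longrightarrow> n < N \<Longrightarrow> S 0 n \<omega> = U 0 n \<omega>"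
    and S_0: "\<omega> \<in> space M \<Longrightarrow> S k 0 \<omega> = u0"
    and S_Suc: "\<omega> \<in> space M \<Longrightarrow> Suc n < N \<Longrightarrow>
      S (Suc k) (Suc n) \<omega> = U (Suc k) (Suc n) \<omega> +
        of_real (cmod (g n \<omega> * (U (Suc k) n \<omega> - U k n \<omega>)) * \<phi> (X (Inr (Suc k, Suc n)) \<omega>))"
begin

definition noise_index :: "(nat + nat \<times> nat) set" where
  "noise_index = Inl ` {..<2 * N} \<union> Inr ` ({1..} \<times> {1..<N})"

text \<open>
  The noise that can influence values computed up to time \<open>n\<close>: fine increments before time \<open>n\<close>, and
  sampling variables of iterations \<open>1, \<dots>, k - 1\<close> at times \<open>1, \<dots>, m - 1\<close>. The bounds \<open>m\<close> and \<open>n\<close> are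
  separate because a sampled value at time \<open>n\<close> uses the sampling variable of time \<open>n\<close> but no increment
  after that time.
\<close>

definition past :: "nat \<Rightarrow> nat \<Rightarrow> nat \<Rightarrow> (nat + nat \<times> nat) set" where
  "past k m n = Inl ` {..<2 * n} \<union> Inr ` ({1..<k} \<times> {1..<m})"

abbreviation "alg \<equiv> noise_algebra M X"

lemma X_measurable: "i \<in> noise_index \<Longrightarrow> X i \<in> borel_measurable M"
  using indep unfolding indep_vars_def noise_index_def by auto

lemma subalgebra_alg: "J \<subseteq> noise_index \<Longrightarrow> subalgebra M (alg J)"
  by (rule subalgebra_noise_algebra) (auto intro: X_measurable)

lemma indep_alg: "J \<subseteq> noise_index \<Longrightarrow> K \<subseteq> noise_index \<Longrightarrow> J \<inter> K = {} \<Longrightarrow>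
    indep_set (sets (alg J)) (sets (alg K))"
  using indep_noise_algebras[OF indep] unfolding noise_index_def by blast

lemma past_subset: "m \<le> N \<Longrightarrow> n \<le> N \<Longrightarrow> past k m n \<subseteq> noise_index"
  unfolding past_def noise_index_def by auto

lemma past_mono: "k \<le> k' \<Longrightarrow> m \<le> m' \<Longrightarrow> n \<le> n' \<Longrightarrow> past k m n \<subseteq> past k' m' n'"
  unfolding past_def by auto

abbreviation "step n \<equiv> {Inl (2 * n), Inl (2 * n + 1)} :: (nat + nat \<times> nat) set"

lemma step_subset: "n < N \<Longrightarrow> step n \<subseteq> noise_index"
  unfolding noise_index_def by auto

lemma step_past: "step n \<inter> past k m n = {}"
  unfolding past_def by auto

lemma step_past_Suc: "m \<le> m' \<Longrightarrow> step n \<union> past k m n \<subseteq> past k m' (Suc n)"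
  unfolding past_def by auto

lemma sq_integrable_cong:
  assumes "\<And>\<omega>. \<omega> \<in> space M \<Longrightarrow> Y \<omega> = Z \<omega>" "sq_integrable (alg J) Z"
  shows "sq_integrable (alg J) Y"
proof -
  have "Y \<in> borel_measurable (alg J) \<longleftrightarrow> Z \<in> borel_measurable (alg J)"
    by (rule measurable_cong) (simp add: assms(1))
  moreover have "integrable M (\<lambda>\<omega>. (cmod (Y \<omega>))\<^sup>2) \<longleftrightarrow> integrable M (\<lambda>\<omega>. (cmod (Z \<omega>))\<^sup>2)"
    by (rule Bochner_Integration.integrable_cong) (simp_all add: assms(1))
  ultimately show ?thesis
    using assms(2) unfolding sq_integrable_def by simp
qed

lemma sq_integrable_const: "sq_integrable (alg J) (\<lambda>_. z)"
  unfolding sq_integrable_def by simp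

lemma fg_sq: "n < N \<Longrightarrow> sq_integrable (alg (step n)) (\<lambda>\<omega>. f n \<omega> - g n \<omega>)"
  using sq_integrable_diff(1)[OF subalgebra_alg[OF step_subset]] f_sq g_sq by blast

lemma sq_integrable_step_mult:
  assumes "n < N" "m \<le> N" "m \<le> m'"
    and "sq_integrable (alg (step n)) h" "sq_integrable (alg (past k m n)) Y"
  shows "sq_integrable (alg (past k m' (Suc n))) (\<lambda>\<omega>. h \<omega> * Y \<omega>)"
  using assms
  by (intro sq_integrable_mono[OF sq_integrable_mult_indep(1)[OF indep_alg], of "step n" "past k m n"]
      step_subset past_subset step_past step_past_Suc) auto

lemma u_sq: "n \<le> N \<Longrightarrow> sq_integrable (alg (past 0 0 n)) (u n)"
proof (induction n)
  case 0
  show ?case by (rule sq_integrable_cong[OF u_0 sq_integrable_const])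
next
  case (Suc n)
  then show ?case
    by (intro sq_integrable_cong[OF u_Suc sq_integrable_step_mult[OF _ _ _ f_sq]]) auto
qed

text \<open>
  The sampling variable at \<open>(k + 1, n + 1)\<close> has index outside the past of the standard deviation that
  it multiplies, and the propagator \<open>g n\<close> inside that standard deviation is in turn independent of the
  two iterates at time \<open>n\<close>. Hence the mean square of the random jump is the product of \<open>1\<close>, \<open>\<gamma>\<close> and
  the mean square difference of consecutive iterates.
\<close>

lemma jump_sq:
  assumes n: "Suc n < N"
    and U: "sq_integrable (alg (past (Suc k) n n)) (U (Suc k) n)"
      "sq_integrable (alg (past k n n)) (U k n)"
  defines "\<sigma> \<equiv> \<lambda>\<omega>. g n \<omega> * (U (Suc k) n \<omega> - U k n \<omega>)"
  defines "j \<equiv> \<lambda>\<omega>. complex_of_real (cmod (\<sigma> \<omega>) * \<phi> (X (Inr (Suc k, Suc n)) \<omega>))"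
  shows "sq_integrable (alg (past (Suc (Suc k)) (Suc (Suc n)) (Suc n))) j"
    and "expectation (\<lambda>\<omega>. (cmod (j \<omega>))\<^sup>2) = \<gamma> * expectation (\<lambda>\<omega>. (cmod (U (Suc k) n \<omega> - U k n \<omega>))\<^sup>2)"
proof -
  let ?J = "past (Suc k) n n" and ?p = "(Suc k, Suc n)"
  let ?K = "past (Suc k) (Suc n) (Suc n)"
  have diff: "sq_integrable (alg ?J) (\<lambda>\<omega>. U (Suc k) n \<omega> - U k n \<omega>)"
    using n by (intro sq_integrable_diff(1) subalgebra_alg past_subset U
        sq_integrable_mono[OF U(2)] past_mono) auto
  have ind: "indep_set (sets (alg (step n))) (sets (alg ?J))"
    using n by (intro indep_alg step_subset past_subset step_past) auto
  have \<sigma>: "sq_integrable (alg ?K) \<sigma>"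
    unfolding \<sigma>_def using n by (intro sq_integrable_step_mult[OF _ _ _ g_sq diff]) auto
  then have \<sigma>': "sq_integrable (alg ?K) (\<lambda>\<omega>. complex_of_real (cmod (\<sigma> \<omega>)))"
    unfolding sq_integrable_def norm_of_real power2_abs by (elim conjE, intro conjI) (measurable)
  have z: "sq_integrable (alg {Inr ?p}) (\<lambda>\<omega>. complex_of_real (\<phi> (X (Inr ?p) \<omega>)))"
  proof -
    have [measurable]: "X (Inr ?p) \<in> borel_measurable (alg {Inr ?p})"
      by (rule measurable_noise_algebra_member) simp
    note [measurable] = \<phi>_borel
    have "(\<lambda>\<omega>. complex_of_real (\<phi> (X (Inr ?p) \<omega>))) \<in> borel_measurable (alg {Inr ?p})"
      by measurable
    then show ?thesis
      unfolding sq_integrable_def using n sample_sq[of ?p] by simp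
  qed
  have ind': "indep_set (sets (alg ?K)) (sets (alg {Inr ?p}))"
    using n by (intro indep_alg past_subset) (auto simp: noise_index_def past_def)
  have j: "j = (\<lambda>\<omega>. complex_of_real (cmod (\<sigma> \<omega>)) * complex_of_real (\<phi> (X (Inr ?p) \<omega>)))"
    unfolding j_def by simp
  show "sq_integrable (alg (past (Suc (Suc k)) (Suc (Suc n)) (Suc n))) j"
    unfolding j by (rule sq_integrable_mono[OF sq_integrable_mult_indep(1)[OF ind' \<sigma>' z]])
      (auto simp: past_def)
  show "expectation (\<lambda>\<omega>. (cmod (j \<omega>))\<^sup>2) = \<gamma> * expectation (\<lambda>\<omega>. (cmod (U (Suc k) n \<omega> - U k n \<omega>))\<^sup>2)"
    unfolding j sq_integrable_mult_indep(2)[OF ind' \<sigma>' z]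
    using sample_var[of ?p] n sq_integrable_mult_indep(2)[OF ind g_sq diff] g_moment[of n]
    by (simp add: \<sigma>_def)
qed

lemma S_sq:
  assumes U: "\<And>j n. j \<le> k \<Longrightarrow> n \<le> N \<Longrightarrow> sq_integrable (alg (past j n n)) (U j n)" and n: "n < N"
  shows "sq_integrable (alg (past (Suc k) (Suc n) n)) (S k n)"
proof (cases n)
  case 0
  show ?thesis unfolding 0 by (rule sq_integrable_cong[OF S_0 sq_integrable_const])
next
  case (Suc m)
  show ?thesis
  proof (cases k)
    case 0
    show ?thesis
      unfolding 0 using n
      by (intro sq_integrable_cong[OF S_init[OF _ n] sq_integrable_mono[OF U[of 0 n] past_mono]]) auto
  next
    case (Suc l)
    have *: "Suc m < N" using n \<open>n = Suc m\<close> by simp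
    show ?thesis
      unfolding \<open>n = Suc m\<close> Suc
    proof (rule sq_integrable_cong[OF S_Suc[OF _ *] sq_integrable_add(1)])
      show "sq_integrable (alg (past (Suc (Suc l)) (Suc (Suc m)) (Suc m))) (U (Suc l) (Suc m))"
        using * Suc by (intro sq_integrable_mono[OF U] past_mono) auto
    next
      show "subalgebra M (alg (past (Suc (Suc l)) (Suc (Suc m)) (Suc m)))"
        using * by (intro subalgebra_alg past_subset) auto
      show "sq_integrable (alg (past (Suc (Suc l)) (Suc (Suc m)) (Suc m)))
          (\<lambda>\<omega>. complex_of_real (cmod (g m \<omega> * (U (Suc l) m \<omega> - U l m \<omega>))
            * \<phi> (X (Inr (Suc l, Suc m)) \<omega>)))"
        using * Suc by (intro jump_sq(1) U) auto
    qed
  qed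
qed

text \<open>
  Measurability and square integrability have to be proved together, by induction on \<open>k\<close> and then on
  \<open>n\<close>: square integrability of each new product relies on independence, hence on knowing what the
  previous values depend on. The induction on \<open>k\<close> is a complete one because a sampled value of
  iteration \<open>k\<close> involves the iterates \<open>k\<close> and \<open>k - 1\<close>.
\<close>

lemma U_sq: "n \<le> N \<Longrightarrow> sq_integrable (alg (past k n n)) (U k n)"
proof (induction k arbitrary: n rule: less_induct)
  case (less k)
  note IH = less.IH
  show ?case
    using less.prems
  proof (induction n)
    case 0
    show ?case by (rule sq_integrable_cong[OF U_0 sq_integrable_const])
  next
    case (Suc n)
    then have n: "n < N" and U: "sq_integrable (alg (past k n n)) (U k n)" by auto
    have gU: "sq_integrable (alg (past k (Suc n) (Suc n))) (\<lambda>\<omega>. g n \<omega> * U k n \<omega>)"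
      using n U g_sq by (intro sq_integrable_step_mult) auto
    show ?case
    proof (cases k)
      case 0
      then show ?thesis
        using sq_integrable_cong[OF U_init[OF _ n]] gU by simp
    next
      case (Suc l)
      have "sq_integrable (alg (past k (Suc n) n)) (S l n)"
        unfolding Suc using IH n Suc by (intro S_sq) auto
      then have "sq_integrable (alg (past k (Suc n) (Suc n))) (\<lambda>\<omega>. (f n \<omega> - g n \<omega>) * S l n \<omega>)"
        using n fg_sq by (intro sq_integrable_step_mult) auto
      with gU n show ?thesis
        unfolding Suc
        by (intro sq_integrable_cong[OF U_Suc[OF _ n]] sq_integrable_add subalgebra_alg past_subset) auto
    qed
  qed
qed

definition err :: "nat \<Rightarrow> nat \<Rightarrow> real" where
  "err k n = expectation (\<lambda>\<omega>. (cmod (U k n \<omega> - u n \<omega>))\<^sup>2)"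

definition sample_err :: "nat \<Rightarrow> nat \<Rightarrow> real" where
  "sample_err k n = expectation (\<lambda>\<omega>. (cmod (S k n \<omega> - u n \<omega>))\<^sup>2)"

lemma U_err_sq:
  assumes "n \<le> N" shows "sq_integrable (alg (past k n n)) (\<lambda>\<omega>. U k n \<omega> - u n \<omega>)"
  using assms U_sq[of n k]
  by (intro sq_integrable_diff(1) subalgebra_alg past_subset sq_integrable_mono[OF u_sq] past_mono) auto

text \<open>
  Subtracting the fine recursion from the scheme writes the new error as
  \<open>g n * (U - u) + (f n - g n) * (S - u)\<close>, which is linear in the old errors with coefficients
  independent of them.
\<close>

lemma err_step:
  assumes n: "n < N"
  shows "err (Suc k) (Suc n) \<le> (\<gamma> + c) * err (Suc k) n + (\<delta> + c) * sample_err k n"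
proof -
  let ?J = "past (Suc k) (Suc n) n"
  have e: "sq_integrable (alg ?J) (\<lambda>\<omega>. U (Suc k) n \<omega> - u n \<omega>)"
    using n by (intro sq_integrable_mono[OF U_err_sq] past_mono) auto
  have s: "sq_integrable (alg ?J) (\<lambda>\<omega>. S k n \<omega> - u n \<omega>)"
    using n U_sq by (intro sq_integrable_diff(1) S_sq subalgebra_alg past_subset
        sq_integrable_mono[OF u_sq] past_mono) auto
  have "err (Suc k) (Suc n) = expectation (\<lambda>\<omega>.
      (cmod (g n \<omega> * (U (Suc k) n \<omega> - u n \<omega>) + (f n \<omega> - g n \<omega>) * (S k n \<omega> - u n \<omega>)))\<^sup>2)"
    unfolding err_def using n
    by (intro Bochner_Integration.integral_cong refl)
       (simp add: U_Suc u_Suc algebra_simps)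
  also have "\<dots> \<le> (\<gamma> + c) * err (Suc k) n + (\<delta> + c) * sample_err k n"
  proof -
    have "indep_set (sets (alg (step n))) (sets (alg ?J))"
      using n by (intro indep_alg step_subset past_subset step_past) auto
    then show ?thesis
      unfolding err_def sample_err_def
      using step_subset[OF n] past_subset[of "Suc n" n "Suc k"] n
      by (intro indep_linear_step_bound[OF _ _ _ g_sq[OF n] fg_sq[OF n] e s,
            unfolded g_moment[OF n] d_moment[OF n] gd_moment[OF n]] X_measurable) auto
  qed
  finally show ?thesis .
qed

lemma sample_err_init: "n < N \<Longrightarrow> sample_err 0 n = err 0 n"
  unfolding sample_err_def err_def
  by (intro Bochner_Integration.integral_cong refl) (simp add: S_init)

lemma sample_err_start: "sample_err k 0 = 0" and err_start: "err k 0 = 0"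
proof -
  have "sample_err k 0 = expectation (\<lambda>_. 0)" "err k 0 = expectation (\<lambda>_. 0)"
    unfolding sample_err_def err_def
    by (intro Bochner_Integration.integral_cong refl, simp add: S_0 U_0 u_0)+
  then show "sample_err k 0 = 0" "err k 0 = 0" by simp_all
qed

lemma \<gamma>_nonneg: "0 < N \<Longrightarrow> 0 \<le> \<gamma>"
  using g_moment[of 0] Bochner_Integration.integral_nonneg[of M "\<lambda>\<omega>. (cmod (g 0 \<omega>))\<^sup>2"] by simp

text \<open>
  The triangle inequality in its squared form, applied twice: to the sampled value as iterate plus
  jump, and, inside the jump, to the difference of two iterates through the fine solution. These two
  uses produce the factors \<open>2\<close> and \<open>4\<close> in the final rate.
\<close>

lemma sample_err_step:
  assumes n: "Suc n < N"
  shows "sample_err (Suc k) (Suc n) \<le> 2 * err (Suc k) (Suc n) + 4 * \<gamma> * (err (Suc k) n + err k n)"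
proof -
  let ?J = "past (Suc (Suc k)) (Suc (Suc n)) (Suc n)" and ?L = "past (Suc k) n n"
  have sJ: "subalgebra M (alg ?J)" and sL: "subalgebra M (alg ?L)"
    using n by (intro subalgebra_alg past_subset; simp)+
  define j where "j = (\<lambda>\<omega>. complex_of_real (cmod (g n \<omega> * (U (Suc k) n \<omega> - U k n \<omega>))
      * \<phi> (X (Inr (Suc k, Suc n)) \<omega>)))"
  have j: "sq_integrable (alg ?J) j"
      "expectation (\<lambda>\<omega>. (cmod (j \<omega>))\<^sup>2) = \<gamma> * expectation (\<lambda>\<omega>. (cmod (U (Suc k) n \<omega> - U k n \<omega>))\<^sup>2)"
    unfolding j_def using n by (intro jump_sq U_sq; simp)+
  have e: "sq_integrable (alg ?J) (\<lambda>\<omega>. U (Suc k) (Suc n) \<omega> - u (Suc n) \<omega>)"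
    using n by (intro sq_integrable_mono[OF U_err_sq] past_mono) auto
  have "sample_err (Suc k) (Suc n)
      = expectation (\<lambda>\<omega>. (cmod ((U (Suc k) (Suc n) \<omega> - u (Suc n) \<omega>) + j \<omega>))\<^sup>2)"
    unfolding sample_err_def using n
    by (intro Bochner_Integration.integral_cong refl) (simp add: S_Suc j_def algebra_simps)
  also have "\<dots> \<le> 2 * err (Suc k) (Suc n) + 2 * expectation (\<lambda>\<omega>. (cmod (j \<omega>))\<^sup>2)"
    unfolding err_def by (rule sq_integrable_add(2)[OF sJ e j(1)])
  also have "\<dots> \<le> 2 * err (Suc k) (Suc n) + 2 * (\<gamma> * (2 * err (Suc k) n + 2 * err k n))"
  proof -
    have "sq_integrable (alg ?L) (\<lambda>\<omega>. U (Suc k) n \<omega> - u n \<omega>)"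
        "sq_integrable (alg ?L) (\<lambda>\<omega>. U k n \<omega> - u n \<omega>)"
      using n by (intro sq_integrable_mono[OF U_err_sq] past_mono; simp)+
    from sq_integrable_diff(2)[OF sL this]
    have "expectation (\<lambda>\<omega>. (cmod (U (Suc k) n \<omega> - U k n \<omega>))\<^sup>2) \<le> 2 * err (Suc k) n + 2 * err k n"
      unfolding err_def by simp
    then show ?thesis
      unfolding j(2) using \<gamma>_nonneg n by (intro add_left_mono mult_left_mono) auto
  qed
  finally show ?thesis by (simp add: algebra_simps)
qed

lemma sup_err_bound:
  assumes "0 < N" "\<gamma> + c < 1"
  defines "P \<equiv> 2 * (\<delta> + c) * (1 + 2 * \<gamma>) / (1 - (\<gamma> + c))"
    and "Q \<equiv> 4 * (\<delta> + c) * \<gamma> / (1 - (\<gamma> + c))"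
  shows "(SUP n\<in>{0..N}. err k n) \<le> (SUP n\<in>{0..N}. err 0 n) * ((P + sqrt (P\<^sup>2 + 4 * Q)) / 2) ^ k"
proof -
  have nonneg: "0 \<le> \<gamma>" "0 \<le> \<delta>" "0 \<le> c"
    using \<gamma>_nonneg gd_moment[of 0] d_moment[of 0] \<open>0 < N\<close>
      Bochner_Integration.integral_nonneg[of M "\<lambda>\<omega>. (cmod (f 0 \<omega> - g 0 \<omega>))\<^sup>2"]
    by auto
  show ?thesis
    unfolding P_def Q_def
  proof (rule sup_error_geometric_bound[where s = sample_err])
    show "0 \<le> err k n" for k n unfolding err_def by (rule Bochner_Integration.integral_nonneg) simp
  qed (use nonneg assms(2) in \<open>simp_all add: err_start sample_err_start sample_err_init err_step sample_err_step\<close>)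
qed

end

section \<open>Moments of the propagators\<close>

context prob_space
begin

definition standardized :: "('a \<Rightarrow> real) \<Rightarrow> bool" where
  "standardized x \<longleftrightarrow> x \<in> borel_measurable M \<and> integrable M (\<lambda>\<omega>. (x \<omega>)\<^sup>2)
     \<and> expectation x = 0 \<and> expectation (\<lambda>\<omega>. (x \<omega>)\<^sup>2) = 1"

lemma standardized_integrable: "standardized x \<Longrightarrow> integrable M x"
  unfolding standardized_def using square_integrable_imp_integrable by blast

lemma standardized_std_normal:
  assumes D: "distributed M lborel x std_normal_density"
  shows "standardized x"
proof -
  have "x \<in> borel_measurable M"
    using distributed_measurable[OF D] by simp
  moreover have "integrable M (\<lambda>\<omega>. (x \<omega>)\<^sup>2)"
    using distributed_integrable[OF D, of "\<lambda>x. x\<^sup>2"] integrable_std_normal_moment[of 2]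
    by (simp add: normal_density_nonneg)
  moreover have "expectation (\<lambda>\<omega>. (x \<omega>)\<^sup>2) = 1"
    using standard_normal_distributed_variance[OF D] standard_normal_distributed_expectation[OF D]
    by simp
  ultimately show ?thesis
    unfolding standardized_def using standard_normal_distributed_expectation[OF D] by simp
qed

lemma affine_moments:
  fixes a b :: complex
  assumes x: "standardized x"
  shows "integrable M (\<lambda>\<omega>. (cmod (a + b * of_real (x \<omega>)))\<^sup>2)"
    and "expectation (\<lambda>\<omega>. (cmod (a + b * of_real (x \<omega>)))\<^sup>2) = (cmod a)\<^sup>2 + (cmod b)\<^sup>2"
    and "integrable M (\<lambda>\<omega>. a + b * of_real (x \<omega>))"
    and "expectation (\<lambda>\<omega>. a + b * of_real (x \<omega>)) = a"
    and "integrable M (\<lambda>\<omega>. of_real (x \<omega>) * (a + b * of_real (x \<omega>)))"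
    and "expectation (\<lambda>\<omega>. of_real (x \<omega>) * (a + b * of_real (x \<omega>))) = b"
proof -
  note [simp] = standardized_integrable[OF x]
  have [simp]: "integrable M (\<lambda>\<omega>. (x \<omega>)\<^sup>2)" "expectation x = 0"
      "expectation (\<lambda>\<omega>. (x \<omega>)\<^sup>2) = 1"
    using x unfolding standardized_def by auto
  have sq: "(cmod (a + b * of_real v))\<^sup>2 = (cmod a)\<^sup>2 + 2 * Re (a * cnj b) * v + (cmod b)\<^sup>2 * v\<^sup>2" for v
    unfolding cmod_power2 by (simp add: power2_eq_square algebra_simps)
  show "integrable M (\<lambda>\<omega>. (cmod (a + b * of_real (x \<omega>)))\<^sup>2)"
    and "expectation (\<lambda>\<omega>. (cmod (a + b * of_real (x \<omega>)))\<^sup>2) = (cmod a)\<^sup>2 + (cmod b)\<^sup>2"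
    unfolding sq by (simp_all add: prob_space del: times_complex.sel)
  show "integrable M (\<lambda>\<omega>. a + b * of_real (x \<omega>))"
    and "expectation (\<lambda>\<omega>. a + b * of_real (x \<omega>)) = a"
    by (simp_all add: prob_space)
  have lin: "of_real v * (a + b * of_real v) = a * of_real v + b * of_real (v\<^sup>2)" for v
    by (simp add: power2_eq_square algebra_simps)
  show "integrable M (\<lambda>\<omega>. of_real (x \<omega>) * (a + b * of_real (x \<omega>)))"
    and "expectation (\<lambda>\<omega>. of_real (x \<omega>) * (a + b * of_real (x \<omega>))) = b"
    unfolding lin by (simp_all del: of_real_power)
qed

text \<open>
  Every product that occurs is a sum of products of a function of one fine increment and a function
  of the other, so independence reduces every moment to the first and second moments of affine functions of a single
  standardized variable. The factor \<open>sqrt 2\<close> comes from \<open>2 / sqrt 2\<close>: the coarse increment is the sum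
  of the two fine ones divided by \<open>sqrt 2\<close>, and each fine increment contributes the same correlation
  with the fine propagator.
\<close>

lemma propagator_moments:
  fixes a b A B :: complex
  assumes st: "standardized (X i)" "standardized (X j)"
    and ind: "indep_set (sets (noise_algebra M X {j})) (sets (noise_algebra M X {i}))"
  defines "f \<equiv> \<lambda>\<omega>. (a + b * of_real (X j \<omega>)) * (a + b * of_real (X i \<omega>))"
    and "g \<equiv> \<lambda>\<omega>. A + B * of_real ((X i \<omega> + X j \<omega>) / sqrt 2)"
  shows "sq_integrable (noise_algebra M X {i, j}) f"
    and "sq_integrable (noise_algebra M X {i, j}) g"
    and "expectation (\<lambda>\<omega>. (cmod (g \<omega>))\<^sup>2) = (cmod A)\<^sup>2 + (cmod B)\<^sup>2"
    and "expectation (\<lambda>\<omega>. (cmod (f \<omega> - g \<omega>))\<^sup>2)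
      = ((cmod a)\<^sup>2 + (cmod b)\<^sup>2)\<^sup>2 + ((cmod A)\<^sup>2 + (cmod B)\<^sup>2)
        - 2 * Re (A * (cnj a)\<^sup>2 + of_real (sqrt 2) * B * cnj (a * b))"
    and "expectation (\<lambda>\<omega>. g \<omega> * cnj (f \<omega> - g \<omega>))
      = A * (cnj a)\<^sup>2 + of_real (sqrt 2) * B * cnj (a * b) - of_real ((cmod A)\<^sup>2 + (cmod B)\<^sup>2)"
proof -
  let ?F = "noise_algebra M X"
  have meas [measurable]: "X i \<in> borel_measurable (?F {i})" "X j \<in> borel_measurable (?F {j})"
      "X i \<in> borel_measurable (?F {i, j})" "X j \<in> borel_measurable (?F {i, j})"
    by (simp_all add: measurable_noise_algebra_member)
  have sub: "subalgebra M (?F {i, j})"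
    using st by (intro subalgebra_noise_algebra) (auto simp: standardized_def)
  note prods = expectation_mult_algebras[OF ind space_noise_algebra space_noise_algebra]
  have p: "sq_integrable (?F {i}) (\<lambda>\<omega>. a + b * of_real (X i \<omega>))"
    and q: "sq_integrable (?F {j}) (\<lambda>\<omega>. a + b * of_real (X j \<omega>))"
    unfolding sq_integrable_def using affine_moments(1) st by auto
  have union: "{j} \<union> {i} = {i, j}" by auto
  show f: "sq_integrable (?F {i, j}) f"
    using sq_integrable_mult_indep(1)[OF ind q p] unfolding f_def union .
  have f2: "expectation (\<lambda>\<omega>. (cmod (f \<omega>))\<^sup>2) = ((cmod a)\<^sup>2 + (cmod b)\<^sup>2)\<^sup>2"
    unfolding f_def sq_integrable_mult_indep(2)[OF ind q p]
    unfolding affine_moments(2)[OF st(1)] affine_moments(2)[OF st(2)] by (simp add: power2_eq_square)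
  have V: "standardized (\<lambda>\<omega>. (X i \<omega> + X j \<omega>) / sqrt 2)"
  proof -
    note [simp] = standardized_integrable[OF st(1)] standardized_integrable[OF st(2)]
    have [simp]: "integrable M (\<lambda>\<omega>. (X i \<omega>)\<^sup>2)" "integrable M (\<lambda>\<omega>. (X j \<omega>)\<^sup>2)"
        "expectation (X i) = 0" "expectation (X j) = 0"
        "expectation (\<lambda>\<omega>. (X i \<omega>)\<^sup>2) = 1" "expectation (\<lambda>\<omega>. (X j \<omega>)\<^sup>2) = 1"
      and [measurable]: "X i \<in> borel_measurable M" "X j \<in> borel_measurable M"
      using st unfolding standardized_def by auto
    have [simp]: "integrable M (\<lambda>\<omega>. X j \<omega> * X i \<omega>)" "expectation (\<lambda>\<omega>. X j \<omega> * X i \<omega>) = 0"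
      using prods[of "X j" "X i"] by simp_all
    have sq: "((v + w) / sqrt 2)\<^sup>2 = (v\<^sup>2 + w\<^sup>2) / 2 + w * v" for v w :: real
      by (simp add: power_divide power2_sum field_simps)
    show ?thesis
      unfolding standardized_def sq by simp
  qed
  show g: "sq_integrable (?F {i, j}) g"
    unfolding sq_integrable_def g_def using affine_moments(1)[OF V] by simp
  show g2: "expectation (\<lambda>\<omega>. (cmod (g \<omega>))\<^sup>2) = (cmod A)\<^sup>2 + (cmod B)\<^sup>2"
    unfolding g_def by (rule affine_moments(2)[OF V])
  have gf: "expectation (\<lambda>\<omega>. g \<omega> * cnj (f \<omega>))
      = A * (cnj a)\<^sup>2 + of_real (sqrt 2) * B * cnj (a * b)"
  proof -
    define p q where "p \<omega> = cnj a + cnj b * complex_of_real (X i \<omega>)"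
      and "q \<omega> = cnj a + cnj b * complex_of_real (X j \<omega>)" for \<omega>
    have [measurable]: "p \<in> borel_measurable (?F {i})" "q \<in> borel_measurable (?F {j})"
      unfolding p_def q_def by measurable
    note mi = affine_moments(3-6)[OF st(1), of "cnj a" "cnj b", folded p_def]
    note mj = affine_moments(3-6)[OF st(2), of "cnj a" "cnj b", folded q_def]
    let ?xp = "\<lambda>\<omega>. of_real (X i \<omega>) * p \<omega>" and ?yq = "\<lambda>\<omega>. of_real (X j \<omega>) * q \<omega>"
    have [measurable]: "?xp \<in> borel_measurable (?F {i})" "?yq \<in> borel_measurable (?F {j})"
      by measurable
    have pq: "integrable M (\<lambda>\<omega>. q \<omega> * p \<omega>)" "expectation (\<lambda>\<omega>. q \<omega> * p \<omega>) = cnj a * cnj a"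
      using prods[of q p] mi mj by simp_all
    have xpq: "integrable M (\<lambda>\<omega>. q \<omega> * ?xp \<omega>)" "expectation (\<lambda>\<omega>. q \<omega> * ?xp \<omega>) = cnj a * cnj b"
      using prods[of q ?xp] mi mj by simp_all
    have ypq: "integrable M (\<lambda>\<omega>. ?yq \<omega> * p \<omega>)" "expectation (\<lambda>\<omega>. ?yq \<omega> * p \<omega>) = cnj b * cnj a"
      using prods[of ?yq p] mi mj by simp_all
    have "g \<omega> * cnj (f \<omega>) = A * (q \<omega> * p \<omega>)
        + B / of_real (sqrt 2) * (q \<omega> * ?xp \<omega> + ?yq \<omega> * p \<omega>)" for \<omega>
      unfolding g_def f_def p_def q_def by (simp add: algebra_simps add_divide_distrib)
    then have "expectation (\<lambda>\<omega>. g \<omega> * cnj (f \<omega>))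
        = A * (cnj a * cnj a) + B / of_real (sqrt 2) * (cnj a * cnj b + cnj b * cnj a)"
      using pq xpq ypq by simp
    also have "\<dots> = A * (cnj a)\<^sup>2 + of_real (2 / sqrt 2) * B * cnj (a * b)"
      by (simp add: power2_eq_square algebra_simps)
    also have "2 / sqrt 2 = sqrt 2" by (rule real_div_sqrt) simp
    finally show ?thesis .
  qed
  have gg: "expectation (\<lambda>\<omega>. g \<omega> * cnj (g \<omega>)) = of_real ((cmod A)\<^sup>2 + (cmod B)\<^sup>2)"
    unfolding complex_norm_square[symmetric] of_real_power[symmetric] integral_complex_of_real g2 ..
  show "expectation (\<lambda>\<omega>. g \<omega> * cnj (f \<omega> - g \<omega>))
      = A * (cnj a)\<^sup>2 + of_real (sqrt 2) * B * cnj (a * b) - of_real ((cmod A)\<^sup>2 + (cmod B)\<^sup>2)"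
    using integrable_mult_cnj(1)[OF sub g f] integrable_mult_cnj(1)[OF sub g g] gf gg
    by (simp add: right_diff_distrib)
  have f': "sq_integrable (?F {i, j}) (\<lambda>\<omega>. - f \<omega>)"
    using f unfolding sq_integrable_def by simp
  have "expectation (\<lambda>\<omega>. (cmod (f \<omega> - g \<omega>))\<^sup>2) = expectation (\<lambda>\<omega>. (cmod (g \<omega> + - f \<omega>))\<^sup>2)"
    by (simp add: norm_minus_commute)
  also have "\<dots> = ((cmod a)\<^sup>2 + (cmod b)\<^sup>2)\<^sup>2 + ((cmod A)\<^sup>2 + (cmod B)\<^sup>2)
        - 2 * Re (A * (cnj a)\<^sup>2 + of_real (sqrt 2) * B * cnj (a * b))"
    unfolding expectation_norm_add_square[OF sub g f'] g2 gf[symmetric] using f2 by simp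
  finally show "expectation (\<lambda>\<omega>. (cmod (f \<omega> - g \<omega>))\<^sup>2)
      = ((cmod a)\<^sup>2 + (cmod b)\<^sup>2)\<^sup>2 + ((cmod A)\<^sup>2 + (cmod B)\<^sup>2)
        - 2 * Re (A * (cnj a)\<^sup>2 + of_real (sqrt 2) * B * cnj (a * b))" .
qed

text \<open>
  A uniform variable on the unit interval has mean \<open>1 / 2\<close> and variance \<open>1 / 12\<close>; multiplying the
  centred variable by \<open>2 * sqrt 3\<close> multiplies the variance by \<open>12\<close>.
\<close>

lemma standardized_uniform:
  assumes x: "x \<in> borel_measurable M" and D: "distr M lborel x = uniform_measure lborel {0..1}"
  shows "standardized (\<lambda>\<omega>. sqrt 3 * (2 * x \<omega> - 1))"
proof -
  have D': "distributed M lborel x (\<lambda>v. indicator {0..1} v / measure lborel {0..1::real})"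
    unfolding distributed_def using x D
    by (auto simp: uniform_measure_def indicator_def intro!: density_cong)
  have [measurable]: "x \<in> borel_measurable M" by (rule x)
  have bound: "AE \<omega> in M. x \<omega> \<in> {0..1}"
  proof -
    have "AE v in distr M lborel x. v \<in> {0..1}"
      unfolding D by (rule AE_uniform_measureI) auto
    then show ?thesis by (subst (asm) AE_distr_iff) auto
  qed
  have int2: "integrable M (\<lambda>\<omega>. (x \<omega>)\<^sup>2)"
    by (rule integrable_const_bound[of _ 1]) (rule eventually_mono[OF bound], auto simp: power_le_one)
  then have int1: "integrable M x"
    using x square_integrable_imp_integrable by blast
  have E1: "expectation x = 1 / 2"
    using uniform_distributed_expectation[OF D'] by simp
  have "variance x = 1 / 12"
    using uniform_distributed_variance[OF D'] by simp
  then have E2: "expectation (\<lambda>\<omega>. (x \<omega>)\<^sup>2) = 1 / 3"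
    using variance_eq[OF int1 int2] E1 by (simp add: power2_eq_square)
  have sq: "(sqrt 3 * (2 * v - 1))\<^sup>2 = 12 * v\<^sup>2 - 12 * v + 3" for v
    by (simp add: power_mult_distrib power2_eq_square algebra_simps)
  show ?thesis
    unfolding standardized_def sq using int1 int2 E1 E2 by (simp add: prob_space)
qed

text \<open>
  Two internally independent families whose generated information is independent form one
  independent family: a finite intersection of events splits into one intersection from each family,
  and these two are independent. An empty block contributes the whole space.
\<close>

lemma indep_vars_case_sum:
  fixes x :: "'i \<Rightarrow> 'a \<Rightarrow> real" and z :: "'j \<Rightarrow> 'a \<Rightarrow> real"
  assumes x: "indep_vars (\<lambda>_. borel) x A" and z: "indep_vars (\<lambda>_. borel) z B"
    and ind: "indep_set (sets F) (sets H)" and sp: "space F = space M" "space H = space M"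
    and mx: "\<And>i. i \<in> A \<Longrightarrow> x i \<in> borel_measurable F" and mz: "\<And>i. i \<in> B \<Longrightarrow> z i \<in> borel_measurable H"
  shows "indep_vars (\<lambda>_. borel) (case_sum x z) (Inl ` A \<union> Inr ` B)"
proof -
  let ?E = "\<lambda>v. {v -` C \<inter> space M |C. C \<in> sets (borel :: real measure)}"
  have rx: "x i \<in> borel_measurable M" if "i \<in> A" for i using x that unfolding indep_vars_def2 by simp
  have rz: "z i \<in> borel_measurable M" if "i \<in> B" for i using z that unfolding indep_vars_def2 by simp
  \<comment> \<open>Intersecting with the whole space makes the identity meaningful for an empty block as well.\<close>
  have block: "prob (space M \<inter> (\<Inter>i\<in>J. D i)) = (\<Prod>i\<in>J. prob (D i))
        \<and> space M \<inter> (\<Inter>i\<in>J. D i) \<in> sets K"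
    if "indep_vars (\<lambda>_. borel) v C" "J \<subseteq> C" "finite J" "\<And>i. i \<in> J \<Longrightarrow> D i \<in> ?E (v i)"
      "\<And>i. i \<in> C \<Longrightarrow> v i \<in> borel_measurable K" "space K = space M"
    for v :: "'k \<Rightarrow> 'a \<Rightarrow> real" and C J D K
  proof (cases "J = {}")
    case True
    then show ?thesis using sets.top[of K] that(6) by (simp add: prob_space)
  next
    case False
    have D: "D i \<in> sets K" "D i \<subseteq> space M" if "i \<in> J" for i
      using \<open>\<And>i. i \<in> J \<Longrightarrow> D i \<in> ?E (v i)\<close>[OF that] \<open>space K = space M\<close> \<open>J \<subseteq> C\<close> that
        measurable_sets[OF \<open>\<And>i. i \<in> C \<Longrightarrow> v i \<in> borel_measurable K\<close>[of i]] by auto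
    have "space M \<inter> (\<Inter>i\<in>J. D i) = (\<Inter>i\<in>J. D i)"
      using D(2) False by blast
    moreover have "(\<Inter>i\<in>J. D i) \<in> sets K"
      using D(1) False \<open>finite J\<close> by (intro sets.finite_INT) auto
    moreover have "prob (\<Inter>i\<in>J. D i) = (\<Prod>i\<in>J. prob (D i))"
      using that(1-4) False unfolding indep_vars_def2 by (intro indep_setsD[of "\<lambda>i. ?E (v i)" C]) auto
    ultimately show ?thesis by simp
  qed
  have "indep_sets (\<lambda>i. ?E (case_sum x z i)) (Inl ` A \<union> Inr ` B)"
  proof (rule indep_setsI)
    show "?E (case_sum x z i) \<subseteq> events" if "i \<in> Inl ` A \<union> Inr ` B" for i
      using that rx rz by (auto simp: measurable_sets)
  next
    fix D J
    assume J: "J \<noteq> {}" "J \<subseteq> Inl ` A \<union> Inr ` B" "finite J" and D: "\<forall>j\<in>J. D j \<in> ?E (case_sum x z j)"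
    define J1 J2 where "J1 = Inl -` J" and "J2 = Inr -` J"
    have J_eq: "J = Inl ` J1 \<union> Inr ` J2"
      unfolding J1_def J2_def by (auto simp: image_iff) (metis sum.exhaust)
    have fin: "finite J1" "finite J2"
      unfolding J1_def J2_def using J(3) by (auto intro: finite_vimageI)
    have sub: "J1 \<subseteq> A" "J2 \<subseteq> B"
      using J(2) unfolding J1_def J2_def by auto
    have D1: "D (Inl i) \<in> ?E (x i)" if "i \<in> J1" for i
      using D that unfolding J1_def by fastforce
    have D2: "D (Inr i) \<in> ?E (z i)" if "i \<in> J2" for i
      using D that unfolding J2_def by fastforce
    note b1 = block[OF x sub(1) fin(1) D1 mx sp(1)] and b2 = block[OF z sub(2) fin(2) D2 mz sp(2)]
    let ?C1 = "space M \<inter> (\<Inter>i\<in>J1. D (Inl i))" and ?C2 = "space M \<inter> (\<Inter>i\<in>J2. D (Inr i))"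
    have "\<And>j. j \<in> J \<Longrightarrow> D j \<subseteq> space M" using D by blast
    then have "(\<Inter>j\<in>J. D j) = ?C1 \<inter> ?C2"
      using J(1) unfolding J_eq by blast
    also have "prob \<dots> = prob ?C1 * prob ?C2"
      using b1 b2 by (intro indep_setD[OF ind]) auto
    also have "\<dots> = (\<Prod>i\<in>J1. prob (D (Inl i))) * (\<Prod>i\<in>J2. prob (D (Inr i)))"
      using b1 b2 by simp
    also have "\<dots> = (\<Prod>j\<in>J. prob (D j))"
      unfolding J_eq using fin by (subst prod.union_disjoint) (auto simp: prod.reindex)
    finally show "prob (\<Inter>j\<in>J. D j) = (\<Prod>j\<in>J. prob (D j))" .
  qed
  then show ?thesis
    unfolding indep_vars_def2 using rx rz by auto
qed

end

section \<open>The Wiener process and the convergence bound\<close>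

lemma measurable_vimage_component:
  assumes "i \<in> I"
  shows "x i \<in> borel_measurable
    (vimage_algebra \<Omega> (\<lambda>\<omega>. \<lambda>t\<in>I. x t \<omega>) (PiM I (\<lambda>_. borel :: real measure)))"
proof -
  have "(\<lambda>\<omega>. \<lambda>t\<in>I. x t \<omega>) \<in> vimage_algebra \<Omega> (\<lambda>\<omega>. \<lambda>t\<in>I. x t \<omega>) (PiM I (\<lambda>_. borel)) \<rightarrow>\<^sub>M
      PiM I (\<lambda>_. borel :: real measure)"
    by (rule measurable_vimage_algebra1) (auto simp: space_PiM)
  from measurable_compose[OF this measurable_component_singleton[OF assms]] assms
  show ?thesis by simp
qed

lemma fine_noise_eq:
  "fine_noise W DT n j = normalized_increment W (DT / 2) (real (2 * n + j) * (DT / 2))"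
proof -
  have "real n * DT + real j * (DT / 2) = real (2 * n + j) * (DT / 2)" by (simp add: field_simps)
  then show ?thesis unfolding fine_noise_def by (simp only:)
qed

lemma coarse_noise_eq:
  assumes "0 < DT"
  shows "coarse_noise W DT n \<omega> = (fine_noise W DT n 0 \<omega> + fine_noise W DT n 1 \<omega>) / sqrt 2"
proof -
  have times: "real n * DT + real 1 * (DT / 2) + DT / 2 = real n * DT + DT"
      "real n * DT + real 0 * (DT / 2) + DT / 2 = real n * DT + real 1 * (DT / 2)"
      "real n * DT + real 0 * (DT / 2) = real n * DT"
    by (simp_all add: field_simps)
  have "sqrt DT = sqrt (DT / 2) * sqrt 2"
    by (simp add: real_sqrt_mult[symmetric])
  then show ?thesis
    unfolding coarse_noise_def fine_noise_def normalized_increment_def times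
    by (simp add: add_divide_distrib[symmetric])
qed

theorem theorem3p1:
  fixes M :: "'w measure"
    and W :: "real \<Rightarrow> 'w \<Rightarrow> real"
    and T DT Dt \<theta>g \<theta>f \<alpha> \<beta> \<gamma> :: real
    and N k :: nat
    and lam mu u0 a b A B :: complex
    and u :: "nat \<Rightarrow> 'w \<Rightarrow> complex"
    and U S :: "nat \<Rightarrow> nat \<Rightarrow> 'w \<Rightarrow> complex"
    and \<epsilon> :: "nat \<Rightarrow> nat \<Rightarrow> real"
    and \<epsilon>hat :: "nat \<Rightarrow> real"
    and F G :: "nat \<Rightarrow> 'w \<Rightarrow> complex \<Rightarrow> complex"
  assumes "prob_space M"
    and "0 < T" and "0 < N" and "DT = T / real N" and "Dt = DT / 2"
    and "standard_wiener M T W"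
    and "\<theta>g \<in> {0..1}" and "\<theta>f \<in> {0..1}"
    and "u0 \<noteq> 0"
    and "1 - of_real (\<theta>f * Dt) * lam \<noteq> 0" and "1 - of_real (\<theta>g * DT) * lam \<noteq> 0"
    and "a = theta_drift \<theta>f Dt lam" and "b = theta_noise \<theta>f Dt lam mu"
    and "A = theta_drift \<theta>g DT lam" and "B = theta_noise \<theta>g DT lam mu"
    and "F = fine_prop a b W DT" and "G = coarse_prop A B W DT"
    and "Im (A * (cnj a)\<^sup>2 + of_real (sqrt 2) * B * cnj (a * b)) = 0"
    and "u = serial_fine F u0"
    and "sparareal_scheme M N F G u0 U S"
    and "sampling_rule_2 M T N W G U S \<or> sampling_rule_4 M T N W G U S"
    and "\<And>k n. \<epsilon> k n = mean_square_error M (U k n) (u n)"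
    and "\<And>k. \<epsilon>hat k = (SUP n\<in>{0..N}. \<epsilon> k n)"
    and "\<gamma> = (cmod A)\<^sup>2 + (cmod B)\<^sup>2"
    and "\<alpha> = (cmod A)\<^sup>2 + (cmod B)\<^sup>2
             + cmod (A * (cnj a)\<^sup>2 - of_real ((cmod B)\<^sup>2) - of_real ((cmod A)\<^sup>2)
                     + of_real (sqrt 2) * B * cnj (a * b))"
    and "\<beta> = - 2 * Re (cnj A * a\<^sup>2) + (cmod A)\<^sup>2 + (cmod B)\<^sup>2
             - 2 * sqrt 2 * Re (cnj B * a * b) + ((cmod a)\<^sup>2 + (cmod b)\<^sup>2)\<^sup>2
             + cmod (A * (cnj a)\<^sup>2 - of_real ((cmod B)\<^sup>2) - of_real ((cmod A)\<^sup>2)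
                     + of_real (sqrt 2) * B * cnj (a * b))"
    and "\<alpha> < 1"
  shows "\<epsilon>hat k \<le> \<epsilon>hat 0 *
           ((2 * \<beta> * (1 + 2 * \<gamma>) / (1 - \<alpha>)
             + sqrt ((2 * \<beta> * (1 + 2 * \<gamma>) / (1 - \<alpha>))\<^sup>2 + 4 * (4 * \<beta> * \<gamma> / (1 - \<alpha>)))) / 2) ^ k"
proof -
  interpret prob_space M by fact
  note wiener = \<open>standard_wiener M T W\<close>[unfolded standard_wiener_def]
  note scheme = \<open>sparareal_scheme M N F G u0 U S\<close>[unfolded sparareal_scheme_def]
  note coeffs = \<open>\<gamma> = _\<close> \<open>\<alpha> = _\<close> \<open>\<beta> = _\<close>
  let ?P = "{1..} \<times> {1..<N} :: (nat \<times> nat) set"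
  have DT: "0 < DT" "real N * DT = T"
    using \<open>0 < T\<close> \<open>0 < N\<close> \<open>DT = _\<close> by simp_all
  then have Dt: "0 < Dt" "real (2 * N) * Dt = T"
    unfolding \<open>Dt = _\<close> by simp_all
  define x where "x i = normalized_increment W Dt (real i * Dt)" for i :: nat
  define f where "f n \<omega> = (a + b * of_real (x (2 * n + 1) \<omega>)) * (a + b * of_real (x (2 * n) \<omega>))"
    for n \<omega>
  define g where "g n \<omega> = A + B * of_real ((x (2 * n) \<omega> + x (2 * n + 1) \<omega>) / sqrt 2)" for n \<omega>
  have F_eq: "F n \<omega> v = f n \<omega> * v" for n \<omega> v
    unfolding \<open>F = _\<close> fine_prop_def fine_noise_eq f_def x_def \<open>Dt = _\<close> by simp
  have G_eq: "G n \<omega> v = g n \<omega> * v" for n \<omega> v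
    unfolding \<open>G = _\<close> coarse_prop_def coarse_noise_eq[OF DT(1)] fine_noise_eq g_def x_def \<open>Dt = _\<close>
    by simp
  have grid: "real i * Dt \<in> {0..T}" if "i \<le> 2 * N" for i
    using that Dt(1) Dt(2)[symmetric] by (simp add: mult_right_mono)
  have x_eq: "x i = (\<lambda>\<omega>. (W (real (Suc i) * Dt) \<omega> - W (real i * Dt) \<omega>) / sqrt Dt)" for i
    unfolding x_def normalized_increment_def by (rule ext) (simp add: algebra_simps)
  have x_std: "standardized (x i)" if i: "i < 2 * N" for i
  proof (rule standardized_std_normal)
    have "distributed M lborel (\<lambda>\<omega>. W (real (Suc i) * Dt) \<omega> - W (real i * Dt) \<omega>)
        (normal_density 0 (sqrt (real (Suc i) * Dt - real i * Dt)))"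
      using wiener grid[of i] grid[of "Suc i"] i Dt(1) by simp
    then have "distributed M lborel (\<lambda>\<omega>. W (real (Suc i) * Dt) \<omega> - W (real i * Dt) \<omega>)
        (normal_density 0 (sqrt Dt))"
      by (simp add: algebra_simps)
    then show "distributed M lborel (x i) std_normal_density"
      unfolding x_eq by (subst (asm) normal_standard_normal_convert) (use Dt(1) in auto)
  qed
  have x_indep: "indep_vars (\<lambda>_. borel) x {..<2 * N}"
  proof -
    have increments: "indep_vars (\<lambda>_. borel) (\<lambda>i \<omega>. W (t (Suc i)) \<omega> - W (t i) \<omega>) {..<m}"
      if "(\<forall>i\<le>m. t i \<in> {0..T}) \<and> (\<forall>i<m. t i < t (Suc i))" for m and t :: "nat \<Rightarrow> real"
      using wiener that by simp
    have "indep_vars (\<lambda>_. borel) (\<lambda>i \<omega>. W (real (Suc i) * Dt) \<omega> - W (real i * Dt) \<omega>) {..<2 * N}"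
      by (rule increments[of "2 * N" "\<lambda>i. real i * Dt"]) (use grid Dt(1) in auto)
    from indep_vars_compose2[OF this, of "\<lambda>_ v. v / sqrt Dt" "\<lambda>_. borel"] show ?thesis
      unfolding x_eq by simp
  qed
  \<comment> \<open>Both sampling rules are instances of one statement about raw sampling variables and a standardizing map.\<close>
  have key: ?thesis
    if z: "indep_noise M T W ?P z" and \<phi>: "\<phi> \<in> borel_measurable borel"
      and z_std: "\<And>p. p \<in> ?P \<Longrightarrow> standardized (\<lambda>\<omega>. \<phi> (z p \<omega>))"
      and S: "\<And>k n \<omega>. k \<in> {1..} \<Longrightarrow> n \<in> {1..<N} \<Longrightarrow> \<omega> \<in> space M \<Longrightarrow>
        S k n \<omega> = U k n \<omega> + of_real (sampling_sd G U k n \<omega> * \<phi> (z (k, n) \<omega>))"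
    for z :: "nat \<times> nat \<Rightarrow> 'w \<Rightarrow> real" and \<phi> :: "real \<Rightarrow> real"
  proof -
    define X where "X = case_sum x z"
    have X_simps: "X (Inl i) = x i" "X (Inr p) = z p" for i p
      unfolding X_def by simp_all
    have X_indep: "indep_vars (\<lambda>_. borel) X (Inl ` {..<2 * N} \<union> Inr ` ?P)"
      unfolding X_def
    proof (rule indep_vars_case_sum[OF x_indep])
      let ?FW = "vimage_algebra (space M) (\<lambda>\<omega>. \<lambda>t\<in>{0..T}. W t \<omega>) (PiM {0..T} (\<lambda>_. borel :: real measure))"
      let ?Fz = "vimage_algebra (space M) (\<lambda>\<omega>. \<lambda>p\<in>?P. z p \<omega>) (PiM ?P (\<lambda>_. borel :: real measure))"
      show "indep_vars (\<lambda>_. borel) z ?P" and "indep_set (sets ?FW) (sets ?Fz)"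
        using z unfolding indep_noise_def by blast+
      show "x i \<in> borel_measurable ?FW" if "i \<in> {..<2 * N}" for i
      proof -
        have [measurable]: "W (real i * Dt) \<in> borel_measurable ?FW"
            "W (real (Suc i) * Dt) \<in> borel_measurable ?FW"
          using that by (intro measurable_vimage_component grid; simp)+
        show ?thesis unfolding x_eq by measurable
      qed
      show "z p \<in> borel_measurable ?Fz" if "p \<in> ?P" for p
        using that by (rule measurable_vimage_component)
    qed simp_all
    \<comment> \<open>\<open>e\<close> is the mean of \<open>g n * cnj (f n)\<close>, the correlation of the two propagators.\<close>
    define e where "e = A * (cnj a)\<^sup>2 + of_real (sqrt 2) * B * cnj (a * b)"
    define c where "c = cmod (e - of_real \<gamma>)"
    define \<delta> where "\<delta> = ((cmod a)\<^sup>2 + (cmod b)\<^sup>2)\<^sup>2 + \<gamma> - 2 * Re e"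
    have \<alpha>: "\<alpha> = \<gamma> + c"
      unfolding coeffs c_def e_def by (simp add: algebra_simps)
    have \<beta>: "\<beta> = \<delta> + c"
    proof -
      have "Re (cnj A * a\<^sup>2) = Re (A * (cnj a)\<^sup>2)"
        by (metis cnj.simps(1) complex_cnj_cnj complex_cnj_mult complex_cnj_power)
      moreover have "Re (of_real (sqrt 2) * B * cnj (a * b)) = sqrt 2 * Re (cnj B * a * b)"
        by (simp add: algebra_simps)
      ultimately show ?thesis
        unfolding coeffs c_def \<delta>_def e_def by (simp add: algebra_simps)
    qed
    have moments: "sq_integrable (noise_algebra M X {Inl (2 * n), Inl (2 * n + 1)}) (f n)"
        "sq_integrable (noise_algebra M X {Inl (2 * n), Inl (2 * n + 1)}) (g n)"
        "expectation (\<lambda>\<omega>. (cmod (g n \<omega>))\<^sup>2) = \<gamma>"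
        "expectation (\<lambda>\<omega>. (cmod (f n \<omega> - g n \<omega>))\<^sup>2) = \<delta>"
        "cmod (expectation (\<lambda>\<omega>. g n \<omega> * cnj (f n \<omega> - g n \<omega>))) = c"
      if "n < N" for n
    proof -
      have st: "standardized (X (Inl (2 * n)))" "standardized (X (Inl (2 * n + 1)))"
        unfolding X_simps using x_std that by simp_all
      have ind: "indep_set (sets (noise_algebra M X {Inl (2 * n + 1)}))
          (sets (noise_algebra M X {Inl (2 * n)}))"
        using that by (intro indep_noise_algebras[OF X_indep]) auto
      have f_n: "f n = (\<lambda>\<omega>. (a + b * of_real (X (Inl (2 * n + 1)) \<omega>))
            * (a + b * of_real (X (Inl (2 * n)) \<omega>)))"
        and g_n: "g n = (\<lambda>\<omega>. A + B * of_real ((X (Inl (2 * n)) \<omega> + X (Inl (2 * n + 1)) \<omega>) / sqrt 2))"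
        unfolding f_def g_def X_simps by (rule ext, rule refl)+
      show "sq_integrable (noise_algebra M X {Inl (2 * n), Inl (2 * n + 1)}) (f n)"
        unfolding f_n by (rule propagator_moments(1)[OF st ind])
      show "sq_integrable (noise_algebra M X {Inl (2 * n), Inl (2 * n + 1)}) (g n)"
        unfolding g_n by (rule propagator_moments(2)[OF st ind])
      show "expectation (\<lambda>\<omega>. (cmod (g n \<omega>))\<^sup>2) = \<gamma>"
        unfolding g_n coeffs(1) by (rule propagator_moments(3)[OF st ind])
      show "expectation (\<lambda>\<omega>. (cmod (f n \<omega> - g n \<omega>))\<^sup>2) = \<delta>"
        unfolding f_n g_n \<delta>_def e_def coeffs(1) by (rule propagator_moments(4)[OF st ind])
      have "expectation (\<lambda>\<omega>. g n \<omega> * cnj (f n \<omega> - g n \<omega>)) = e - of_real \<gamma>"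
        unfolding f_n g_n e_def coeffs(1) by (rule propagator_moments(5)[OF st ind])
      then show "cmod (expectation (\<lambda>\<omega>. g n \<omega> * cnj (f n \<omega> - g n \<omega>))) = c"
        unfolding c_def by simp
    qed
    interpret parareal_error M X N f g \<phi> u0 u U S \<gamma> \<delta> c
    proof
      show "integrable M (\<lambda>\<omega>. (\<phi> (X (Inr p) \<omega>))\<^sup>2)"
          "expectation (\<lambda>\<omega>. (\<phi> (X (Inr p) \<omega>))\<^sup>2) = 1" if "p \<in> ?P" for p
        using z_std[OF that] unfolding X_simps standardized_def by simp_all
      show "S (Suc k) (Suc n) \<omega> = U (Suc k) (Suc n) \<omega> +
          of_real (cmod (g n \<omega> * (U (Suc k) n \<omega> - U k n \<omega>)) * \<phi> (X (Inr (Suc k, Suc n)) \<omega>))"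
        if "\<omega> \<in> space M" "Suc n < N" for k n \<omega>
        using S[of "Suc k" "Suc n" \<omega>] that
        by (simp add: X_simps sampling_sd_def G_eq right_diff_distrib)
    qed (use scheme moments X_indep \<phi> in
        \<open>auto simp: \<open>u = _\<close> F_eq G_eq left_diff_distrib\<close>)
    have "\<epsilon> k n = err k n" for k n
      unfolding err_def \<open>\<epsilon> k n = _\<close> mean_square_error_def ..
    then show ?thesis
      using sup_err_bound[of k] \<open>0 < N\<close> \<open>\<alpha> < 1\<close> unfolding \<open>\<And>k. \<epsilon>hat k = _\<close> \<alpha> \<beta> by simp
  qed
  from \<open>sampling_rule_2 M T N W G U S \<or> sampling_rule_4 M T N W G U S\<close> show ?thesis
  proof
    assume "sampling_rule_2 M T N W G U S"
    then obtain z where "indep_noise M T W ?P z"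
        "\<forall>p\<in>?P. distributed M lborel (z p) std_normal_density"
        "\<forall>k\<in>{1..}. \<forall>n\<in>{1..<N}. \<forall>\<omega>\<in>space M.
          S k n \<omega> = U k n \<omega> + of_real (sampling_sd G U k n \<omega> * z (k, n) \<omega>)"
      unfolding sampling_rule_2_def by blast
    then show ?thesis
      by (intro key[of z "\<lambda>v. v"]) (auto intro: standardized_std_normal)
  next
    assume "sampling_rule_4 M T N W G U S"
    then obtain r where r: "indep_noise M T W ?P r"
        "\<forall>p\<in>?P. distr M lborel (r p) = uniform_measure lborel {0..1}"
        "\<forall>k\<in>{1..}. \<forall>n\<in>{1..<N}. \<forall>\<omega>\<in>space M.
          S k n \<omega> = U k n \<omega> + of_real (sqrt 3 * sampling_sd G U k n \<omega> * (2 * r (k, n) \<omega> - 1))"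
      unfolding sampling_rule_4_def by blast
    show ?thesis
    proof (rule key[of r "\<lambda>v. sqrt 3 * (2 * v - 1)"])
      show "standardized (\<lambda>\<omega>. sqrt 3 * (2 * r p \<omega> - 1))" if "p \<in> ?P" for p
        using r(1,2) that unfolding indep_noise_def indep_vars_def2
        by (intro standardized_uniform) auto
      show "S k n \<omega> = U k n \<omega> + of_real (sampling_sd G U k n \<omega> * (sqrt 3 * (2 * r (k, n) \<omega> - 1)))"
        if "k \<in> {1..}" "n \<in> {1..<N}" "\<omega> \<in> space M" for k n \<omega>
        using r(3) that by (simp add: ac_simps)
    qed (use r(1) in auto)
  qed
qed

end
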